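(* (a) The set $\{\mu\in\mathcal B: X_\mu\text{ has the local basis structure (LBS)}\}$ is a $\boldsymbol\Sigma^0_4$-set in $\mathcal B$. (b) The set $\{\mu\in\mathcal B: X_\mu\text{ has the local }\Pi\text{-basis structure (L}\Pi\text{BS)}\}$ is a $\boldsymbol\Sigma^0_6$-set in $\mathcal B$.
   Context: All Banach spaces are real. Let $V$ be the vector space over $\mathbb Q$ of all finitely supported sequences of rational numbers. $\mathcal P$ denotes the space of all pseudonorms on $V$, a closed subset of $\mathbb R^V$ with the inherited (Polish) topology of pointwise convergence. Each $\mu\in\mathcal P$ is identified with its unique extension to a pseudonorm on the real vector space $c_{00}$ of finitely supported real sequences, and $X_\mu$ denotes the completion of the quotient of $(c_{00},\mu)$ by $\{x\in c_{00}:\mu(x)=0\}$. $\mathcal B$ is the set of $\mu\in\mathcal P$ whose extension to $c_{00}$ is a norm, with the (Polish) subspace topology. Borel classes are indexed so that open sets are $\boldsymbol\Sigma^0_1$. The basis constant of a basis $(x_i)_{i=1}^d$ of a Banach space of dimension $d$ is the least $C\ge1$ with $\|\sum_{i=1}^n a_ix_i\|\le C\|\sum_{i=1}^m a_ix_i\|$ whenever $n\le m\le d$ and $a_1,\dots,a_m\in\mathbb R$; $\mathrm{bc}(E)$ is the infimum of the basis constants of all bases of $E$. A Banach space $X$ has the local basis structure (LBS) if $X=\overline{\bigcup_{n=1}^\infty E_n}$ where $E_1\subseteq E_2\subseteq\dots$ are finite-dimensional subspaces with $\sup_n\mathrm{bc}(E_n)<\infty$. $X$ has the local $\Pi$-basis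 structure (L$\Pi$BS) if such subspaces can be chosen so that, in addition, there are linear projections $P_n:X\to E_n$ with $P_n(X)=E_n$ and $\sup_n\|P_n\|<\infty$. *)

theory Defs
  imports "HOL-Analysis.Analysis" "HOL-Analysis.Finite_Function_Topology"
    "HOL-Probability.Discrete_Topology"
begin

section \<open>Finite Borel classes\<close>

text \<open>
  The additive classes \<open>\<Sigma>\<^sup>0\<^sub>n\<close> (for finite \<open>n \<ge> 1\<close>) of a topological space: \<open>\<Sigma>\<^sup>0\<^sub>1\<close> consists of
  the open sets, and \<open>\<Sigma>\<^sup>0\<^sub>n\<close> for \<open>n > 1\<close> of the countable unions of sets each of which belongs to
  \<open>\<Pi>\<^sup>0\<^sub>m\<close> for some \<open>1 \<le> m < n\<close>, where \<open>\<Pi>\<^sup>0\<^sub>m\<close> consists of the complements of \<open>\<Sigma>\<^sup>0\<^sub>m\<close> sets.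
  No set is in the (meaningless) class of index 0.
\<close>

inductive Sigma0 :: "'a topology \<Rightarrow> nat \<Rightarrow> 'a set \<Rightarrow> bool"
  for X :: "'a topology"
  where
    Sigma0_open: "openin X U \<Longrightarrow> Sigma0 X 1 U"
  | Sigma0_Union:
      "(\<And>i::nat. 1 \<le> m i \<and> m i < n \<and> A i \<subseteq> topspace X \<and> Sigma0 X (m i) (topspace X - A i))
        \<Longrightarrow> Sigma0 X n (\<Union>i. A i)"


section \<open>Pseudonorms\<close>

type_synonym ratseq = "nat \<Rightarrow>\<^sub>0 rat"
type_synonym c00 = "nat \<Rightarrow>\<^sub>0 real"

definition qscale :: "rat \<Rightarrow> ratseq \<Rightarrow> ratseq"
  where "qscale q v = Poly_Mapping.map ((*) q) v"

definition to_c00 :: "ratseq \<Rightarrow> c00"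
  where "to_c00 v = Poly_Mapping.map of_rat v"

definition rat_pseudonorm :: "(ratseq \<Rightarrow> real) \<Rightarrow> bool"
  where "rat_pseudonorm \<mu> \<longleftrightarrow>
    (\<forall>v. 0 \<le> \<mu> v) \<and>
    (\<forall>u v. \<mu> (u + v) \<le> \<mu> u + \<mu> v) \<and>
    (\<forall>q v. \<mu> (qscale q v) = of_rat \<bar>q\<bar> * \<mu> v)"

definition pseudonorm :: "('a::real_vector \<Rightarrow> real) \<Rightarrow> bool"
  where "pseudonorm \<nu> \<longleftrightarrow>
    (\<forall>x. 0 \<le> \<nu> x) \<and>
    (\<forall>x y. \<nu> (x + y) \<le> \<nu> x + \<nu> y) \<and>
    (\<forall>c x. \<nu> (c *\<^sub>R x) = \<bar>c\<bar> * \<nu> x)"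

definition PN :: "(ratseq \<Rightarrow> real) set"
  where "PN = {\<mu>. rat_pseudonorm \<mu>}"

text \<open>Existence and uniqueness of the extension are shown in \<open>extension\<close> below.\<close>

definition ext :: "(ratseq \<Rightarrow> real) \<Rightarrow> c00 \<Rightarrow> real"
  where "ext \<mu> = (THE \<nu>. pseudonorm \<nu> \<and> (\<forall>v. \<nu> (to_c00 v) = \<mu> v))"

definition BN :: "(ratseq \<Rightarrow> real) set"
  where "BN = {\<mu> \<in> PN. \<forall>x. ext \<mu> x = 0 \<longrightarrow> x = 0}"


section \<open>The Banach space attached to a pseudonorm\<close>

text \<open>
  Isabelle/HOL has no types depending on \<open>\<mu>\<close>, so all the spaces \<open>X\<^sub>\<mu>\<close> are realized as closed
  subspaces of the one Banach space \<open>\<ell>\<^sub>\<infinity>\<close>, the space of bounded (continuous) functions on the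
  discrete space of natural numbers; its elements are written with the copy \<open>nat discrete\<close> of
  \<open>nat\<close> because the library provides completeness for metric domains only.
  The map \<open>canon \<mu>\<close> is a linear map from \<open>c00\<close> with \<open>\<parallel>canon \<mu> x\<parallel> = \<mu> x\<close>; it therefore induces a
  linear isometry on the quotient of \<open>(c00, \<mu>)\<close> by the kernel of \<open>\<mu>\<close>, and the closure of its range
  is the completion of this quotient. Such a map exists for every \<open>\<mu>\<close> in \<open>PN\<close>, see \<open>canon\<close> below;
  the completion is unique up to linear isometry, so it does not matter which one is chosen.
\<close>

instance bcontfun :: (metric_space, banach) banach ..

type_synonym linfty = "nat discrete \<Rightarrow>\<^sub>C real"

definition canon :: "(ratseq \<Rightarrow> real) \<Rightarrow> c00 \<Rightarrow> linfty"
  where "canon \<mu> = (SOME T. linear T \<and> (\<forall>x. norm (T x) = ext \<mu> x))"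

definition Xsp :: "(ratseq \<Rightarrow> real) \<Rightarrow> linfty set"
  where "Xsp \<mu> = closure (range (canon \<mu>))"


section \<open>Local basis structures\<close>

text \<open>
  A basis \<open>x\<^sub>1, \<dots>, x\<^sub>d\<close> of a finite-dimensional space is a list, since its basis constant depends on
  the order. The subspaces and bases below live in an ambient normed space, from which they
  inherit the norm.
\<close>

definition is_basis :: "'a::real_normed_vector set \<Rightarrow> 'a list \<Rightarrow> bool"
  where "is_basis E xs \<longleftrightarrow> distinct xs \<and> independent (set xs) \<and> span (set xs) = E"

definition basis_const :: "'a::real_normed_vector list \<Rightarrow> real"
  where "basis_const xs = (LEAST C. 1 \<le> C \<and>
    (\<forall>n m a. n \<le> m \<and> m \<le> length xs \<longrightarrow>
      norm (\<Sum>i<n. a i *\<^sub>R xs ! i) \<le> C * norm (\<Sum>i<m. a i *\<^sub>R xs ! i)))"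

definition bc :: "'a::real_normed_vector set \<Rightarrow> real"
  where "bc E = Inf (basis_const ` {xs. is_basis E xs})"

definition fin_dim_subspace :: "'a::real_vector set \<Rightarrow> bool"
  where "fin_dim_subspace E \<longleftrightarrow> (\<exists>S. finite S \<and> span S = E)"

definition lbs_chain :: "'a::real_normed_vector set \<Rightarrow> (nat \<Rightarrow> 'a set) \<Rightarrow> bool"
  where "lbs_chain X E \<longleftrightarrow>
    (\<forall>n. fin_dim_subspace (E n)) \<and>
    (\<forall>n. E n \<subseteq> E (Suc n)) \<and>
    X = closure (\<Union>n. E n) \<and>
    bdd_above (range (\<lambda>n. bc (E n)))"

definition LBS :: "'a::banach set \<Rightarrow> bool"
  where "LBS X \<longleftrightarrow> (\<exists>E. lbs_chain X E)"

definition linear_proj :: "'a::real_vector set \<Rightarrow> 'a set \<Rightarrow> ('a \<Rightarrow> 'a) \<Rightarrow> bool"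
  where "linear_proj X E P \<longleftrightarrow>
    (\<forall>x\<in>X. \<forall>y\<in>X. P (x + y) = P x + P y) \<and>
    (\<forall>c. \<forall>x\<in>X. P (c *\<^sub>R x) = c *\<^sub>R P x) \<and>
    P ` X = E \<and> (\<forall>x\<in>X. P (P x) = P x)"

definition LPBS :: "'a::banach set \<Rightarrow> bool"
  where "LPBS X \<longleftrightarrow> (\<exists>E P. lbs_chain X E \<and>
    (\<forall>n. linear_proj X (E n) (P n)) \<and>
    (\<exists>K. \<forall>n. \<forall>x\<in>X. norm (P n x) \<le> K * norm x))"


section \<open>The extension of a pseudonorm to real sequences\<close>

lemma lookup_qscale: "Poly_Mapping.lookup (qscale q v) k = q * Poly_Mapping.lookup v k"
  by (simp add: qscale_def Poly_Mapping.map.rep_eq when_def)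

lemma lookup_to_c00: "Poly_Mapping.lookup (to_c00 v) k = of_rat (Poly_Mapping.lookup v k)"
  by (simp add: to_c00_def Poly_Mapping.map.rep_eq when_def)

lemma lookup_scaleR: "Poly_Mapping.lookup (c *\<^sub>R (x::c00)) k = c * Poly_Mapping.lookup x k"
proof -
  have "finite {i. c * Poly_Mapping.lookup x i \<noteq> 0}"
    by (rule finite_subset[OF _ finite_lookup[of x]]) auto
  then show ?thesis by (simp add: scaleR_poly_mapping_def)
qed

lemma to_c00_add: "to_c00 (u + v) = to_c00 u + to_c00 v"
  by (rule poly_mapping_eqI) (simp add: lookup_to_c00 lookup_add of_rat_add)

lemma to_c00_diff: "to_c00 (u - v) = to_c00 u - to_c00 v"
  by (rule poly_mapping_eqI) (simp add: lookup_to_c00 lookup_minus of_rat_diff)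

lemma to_c00_zero: "to_c00 0 = 0"
  by (rule poly_mapping_eqI) (simp add: lookup_to_c00)

lemma to_c00_qscale: "to_c00 (qscale q v) = of_rat q *\<^sub>R to_c00 v"
  by (rule poly_mapping_eqI) (simp add: lookup_to_c00 lookup_qscale lookup_scaleR of_rat_mult)

lemma to_c00_single: "to_c00 (Poly_Mapping.single k q) = Poly_Mapping.single k (of_rat q)"
  by (rule poly_mapping_eqI) (simp add: lookup_to_c00 lookup_single when_def)

lemma sum_single_keys:
  "(\<Sum>k\<in>Poly_Mapping.keys x. Poly_Mapping.single k (Poly_Mapping.lookup x k)) = x"
  by (rule poly_mapping_eqI) (simp add: lookup_sum lookup_single when_def in_keys_iff)

lemma pseudonormD:
  assumes "pseudonorm \<nu>"
  shows "0 \<le> \<nu> x" "\<nu> (x + y) \<le> \<nu> x + \<nu> y" "\<nu> (c *\<^sub>R x) = \<bar>c\<bar> * \<nu> x"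
    "\<nu> 0 = 0" "\<nu> (- x) = \<nu> x" "\<nu> (x - y) \<le> \<nu> x + \<nu> y" "\<nu> x \<le> \<nu> y + \<nu> (x - y)"
proof -
  show 1: "0 \<le> \<nu> x" "\<nu> (x + y) \<le> \<nu> x + \<nu> y" "\<nu> (c *\<^sub>R x) = \<bar>c\<bar> * \<nu> x" for x y c
    using assms by (auto simp: pseudonorm_def)
  show "\<nu> 0 = 0" using 1(3)[of 0 0] by simp
  show 2: "\<nu> (- x) = \<nu> x" for x using 1(3)[of "-1" x] by simp
  show "\<nu> (x - y) \<le> \<nu> x + \<nu> y" using 1(2)[of x "- y"] 2[of y] by simp
  show "\<nu> x \<le> \<nu> y + \<nu> (x - y)" using 1(2)[of y "x - y"] by simp
qed

lemma rat_approx: "0 < e \<Longrightarrow> \<exists>q. \<bar>a - of_rat q\<bar> < (e::real)"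
  using of_rat_dense[of "a - e" "a + e"] by (auto simp: abs_less_iff) (metis add.commute diff_less_eq less_diff_eq)

lemma to_c00_dense:
  assumes "pseudonorm \<nu>" "0 < e"
  shows "\<exists>v. \<nu> (x - to_c00 v) < e"
proof -
  note p = pseudonormD[OF assms(1)]
  have "finite K \<Longrightarrow> \<forall>e>0. \<exists>v. \<nu> ((\<Sum>k\<in>K. Poly_Mapping.single k (Poly_Mapping.lookup x k)) - to_c00 v) < e"
    for K
  proof (induction K rule: finite_induct)
    case empty
    then show ?case by (auto intro!: exI[of _ 0] simp: to_c00_zero p)
  next
    case (insert k K)
    show ?case
    proof (intro allI impI)
      fix e :: real
      assume e: "e > 0"
      let ?s = "\<Sum>k\<in>K. Poly_Mapping.single k (Poly_Mapping.lookup x k)"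
      let ?a = "Poly_Mapping.lookup x k"
      let ?c = "\<nu> (Poly_Mapping.single k 1)"
      obtain v where v: "\<nu> (?s - to_c00 v) < e / 2"
        using insert.IH e by (meson half_gt_zero)
      have c: "0 < 1 + ?c" using p(1)[of "Poly_Mapping.single k 1"] by linarith
      then obtain q where q: "\<bar>?a - of_rat q\<bar> < e / 2 / (1 + ?c)"
        using rat_approx[of "e / 2 / (1 + ?c)" ?a] e by auto
      have 1: "Poly_Mapping.single k ?a - to_c00 (Poly_Mapping.single k q)
          = (?a - of_rat q) *\<^sub>R (Poly_Mapping.single k 1)"
        by (rule poly_mapping_eqI)
          (simp add: to_c00_single lookup_minus lookup_scaleR lookup_single when_def)
      have "\<bar>?a - of_rat q\<bar> * ?c \<le> \<bar>?a - of_rat q\<bar> * (1 + ?c)"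
        by (intro mult_left_mono) auto
      also have "\<dots> < e / 2" using iffD1[OF pos_less_divide_eq[OF c] q] .
      finally have 2: "\<nu> (Poly_Mapping.single k ?a - to_c00 (Poly_Mapping.single k q)) < e / 2"
        using p(3) 1 by metis
      have "\<nu> ((\<Sum>k\<in>insert k K. Poly_Mapping.single k (Poly_Mapping.lookup x k))
            - to_c00 (v + Poly_Mapping.single k q))
          = \<nu> ((?s - to_c00 v) + (Poly_Mapping.single k ?a - to_c00 (Poly_Mapping.single k q)))"
        using insert.hyps by (simp add: to_c00_add algebra_simps)
      also have "\<dots> < e" using p(2) v 2 by (smt (verit) field_sum_of_halves)
      finally show "\<exists>v. \<nu> ((\<Sum>k\<in>insert k K. Poly_Mapping.single k (Poly_Mapping.lookup x k))
          - to_c00 v) < e" by blast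
    qed
  qed
  from this[OF finite_keys[of x]] show ?thesis using assms(2) by (simp add: sum_single_keys)
qed

lemma extension_unique:
  assumes "pseudonorm \<nu>" "pseudonorm \<nu>'" "\<And>v. \<nu> (to_c00 v) = \<nu>' (to_c00 v)"
  shows "\<nu> x = \<nu>' x"
proof (rule ccontr)
  assume ne: "\<nu> x \<noteq> \<nu>' x"
  have "pseudonorm (\<lambda>x. \<nu> x + \<nu>' x)"
    using assms(1,2) by (auto simp: pseudonorm_def algebra_simps intro: add_mono)
      (smt (verit))
  then obtain v where v: "\<nu> (x - to_c00 v) + \<nu>' (x - to_c00 v) < \<bar>\<nu> x - \<nu>' x\<bar>"
    using to_c00_dense[of "\<lambda>x. \<nu> x + \<nu>' x" "\<bar>\<nu> x - \<nu>' x\<bar>" x] ne by auto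
  note p = pseudonormD[OF assms(1)] pseudonormD[OF assms(2)]
  have "\<nu> (to_c00 v) \<le> \<nu> x + \<nu> (x - to_c00 v)" "\<nu>' (to_c00 v) \<le> \<nu>' x + \<nu>' (x - to_c00 v)"
    using p(7)[of "to_c00 v" x] p(14)[of "to_c00 v" x] p(5)[of "x - to_c00 v"] p(12)[of "x - to_c00 v"]
    by simp_all
  then show False
    using v p(7)[of x "to_c00 v"] p(14)[of x "to_c00 v"] assms(3)[of v] by linarith
qed

definition l1w :: "(nat \<Rightarrow> real) \<Rightarrow> c00 \<Rightarrow> real"
  where "l1w c x = (\<Sum>k\<in>Poly_Mapping.keys x. \<bar>Poly_Mapping.lookup x k\<bar> * c k)"

lemma l1w_superset:
  "finite K \<Longrightarrow> Poly_Mapping.keys x \<subseteq> K \<Longrightarrow> l1w c x = (\<Sum>k\<in>K. \<bar>Poly_Mapping.lookup x k\<bar> * c k)"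
  unfolding l1w_def by (rule sum.mono_neutral_left) (auto simp: in_keys_iff)

lemma pseudonorm_l1w:
  assumes "\<And>k. 0 \<le> c k"
  shows "pseudonorm (l1w c)"
  unfolding pseudonorm_def
proof (intro conjI allI)
  show "0 \<le> l1w c x" for x unfolding l1w_def using assms by (intro sum_nonneg) auto
  show "l1w c (x + y) \<le> l1w c x + l1w c y" for x y
  proof -
    let ?K = "Poly_Mapping.keys x \<union> Poly_Mapping.keys y"
    have "l1w c (x + y) = (\<Sum>k\<in>?K. \<bar>Poly_Mapping.lookup (x + y) k\<bar> * c k)"
      by (rule l1w_superset) (simp_all add: keys_add)
    also have "\<dots> \<le> (\<Sum>k\<in>?K. (\<bar>Poly_Mapping.lookup x k\<bar> + \<bar>Poly_Mapping.lookup y k\<bar>) * c k)"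
      by (intro sum_mono mult_right_mono) (auto simp: lookup_add assms)
    also have "\<dots> = l1w c x + l1w c y"
      by (subst (1 2) l1w_superset[where K = ?K]) (auto simp: sum.distrib algebra_simps)
    finally show ?thesis .
  qed
  show "l1w c (a *\<^sub>R x) = \<bar>a\<bar> * l1w c x" for a x
    by (subst l1w_superset[where K = "Poly_Mapping.keys x"])
      (auto simp: l1w_def in_keys_iff lookup_scaleR abs_mult sum_distrib_left mult.assoc)
qed

lemma rat_pseudonormD:
  assumes "rat_pseudonorm \<mu>"
  shows "0 \<le> \<mu> v" "\<mu> (u + v) \<le> \<mu> u + \<mu> v" "\<mu> (qscale q v) = of_rat \<bar>q\<bar> * \<mu> v" "\<mu> 0 = 0"
proof -
  show 1: "0 \<le> \<mu> v" "\<mu> (u + v) \<le> \<mu> u + \<mu> v" "\<mu> (qscale q v) = of_rat \<bar>q\<bar> * \<mu> v" for q u v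
    using assms by (auto simp: rat_pseudonorm_def)
  have "qscale 0 0 = 0" by (rule poly_mapping_eqI) (simp add: lookup_qscale)
  then show "\<mu> 0 = 0" using 1(3)[of 0 0] by simp
qed

lemma rat_pseudonorm_le_l1w:
  assumes "rat_pseudonorm \<mu>"
  shows "\<mu> v \<le> l1w (\<lambda>k. \<mu> (Poly_Mapping.single k 1)) (to_c00 v)"
proof -
  note p = rat_pseudonormD[OF assms]
  have s: "Poly_Mapping.single k q = qscale q (Poly_Mapping.single k 1)" for k q
    by (rule poly_mapping_eqI) (simp add: lookup_qscale lookup_single when_def)
  have "finite K \<Longrightarrow> \<mu> (\<Sum>k\<in>K. Poly_Mapping.single k (Poly_Mapping.lookup v k))
      \<le> (\<Sum>k\<in>K. \<bar>of_rat (Poly_Mapping.lookup v k)\<bar> * \<mu> (Poly_Mapping.single k 1))" for K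
  proof (induction K rule: finite_induct)
    case (insert k K)
    have "\<mu> (Poly_Mapping.single k (Poly_Mapping.lookup v k))
        = \<bar>of_rat (Poly_Mapping.lookup v k)\<bar> * \<mu> (Poly_Mapping.single k 1)"
      by (subst s) (simp add: p(3))
    then show ?case
      using insert p(2)[of "Poly_Mapping.single k (Poly_Mapping.lookup v k)"
        "\<Sum>k\<in>K. Poly_Mapping.single k (Poly_Mapping.lookup v k)"] by simp
  qed (simp add: p)
  from this[OF finite_keys[of v]]
  have "\<mu> v \<le> (\<Sum>k\<in>Poly_Mapping.keys v. \<bar>of_rat (Poly_Mapping.lookup v k)\<bar> * \<mu> (Poly_Mapping.single k 1))"
    by (simp add: sum_single_keys)
  also have "\<dots> = l1w (\<lambda>k. \<mu> (Poly_Mapping.single k 1)) (to_c00 v)"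
    by (subst l1w_superset[where K = "Poly_Mapping.keys v"]) (auto simp: in_keys_iff lookup_to_c00)
  finally show ?thesis .
qed

lemma extension_exists:
  assumes mu: "rat_pseudonorm \<mu>"
  shows "\<exists>\<nu>. pseudonorm \<nu> \<and> (\<forall>v. \<nu> (to_c00 v) = \<mu> v)"
proof -
  note p = rat_pseudonormD[OF mu]
  define w where "w = l1w (\<lambda>k. \<mu> (Poly_Mapping.single k 1))"
  have w: "pseudonorm w" unfolding w_def by (rule pseudonorm_l1w) (rule p)
  note pw = pseudonormD[OF w]
  have muw: "\<mu> v \<le> w (to_c00 v)" for v
    unfolding w_def by (rule rat_pseudonorm_le_l1w[OF mu])
  define \<nu> where "\<nu> x = (INF v. \<mu> v + w (x - to_c00 v))" for x
  have bdd: "bdd_below (range (\<lambda>v. \<mu> v + w (x - to_c00 v)))" for x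
    by (rule bdd_belowI[of _ 0]) (use p(1) pw(1) in \<open>auto intro: add_nonneg_nonneg\<close>)
  have up: "\<nu> x \<le> \<mu> v + w (x - to_c00 v)" for x v
    unfolding \<nu>_def by (rule cINF_lower[OF bdd]) simp
  have low: "(\<And>v. b \<le> \<mu> v + w (x - to_c00 v)) \<Longrightarrow> b \<le> \<nu> x" for b x
    unfolding \<nu>_def by (rule cINF_greatest) auto
  have nn: "0 \<le> \<nu> x" for x
    by (rule low) (use p(1) pw(1) in \<open>auto intro: add_nonneg_nonneg\<close>)
  have ext: "\<nu> (to_c00 u) = \<mu> u" for u
  proof (rule antisym)
    show "\<nu> (to_c00 u) \<le> \<mu> u" using up[of "to_c00 u" u] pw(4) by simp
    show "\<mu> u \<le> \<nu> (to_c00 u)"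
    proof (rule low)
      fix v
      show "\<mu> u \<le> \<mu> v + w (to_c00 u - to_c00 v)"
        using p(2)[of v "u - v"] muw[of "u - v"] by (simp add: to_c00_diff)
    qed
  qed
  have tri: "\<nu> (x + y) \<le> \<nu> x + \<nu> y" for x y
  proof -
    have "\<nu> (x + y) - (\<mu> v + w (y - to_c00 v)) \<le> \<mu> u + w (x - to_c00 u)" for u v
    proof -
      have "w (x + y - to_c00 (u + v)) \<le> w (x - to_c00 u) + w (y - to_c00 v)"
        using pw(2)[of "x - to_c00 u" "y - to_c00 v"] by (simp add: to_c00_add algebra_simps)
      then show ?thesis using up[of "x + y" "u + v"] p(2)[of u v] by linarith
    qed
    then have "\<nu> (x + y) - (\<mu> v + w (y - to_c00 v)) \<le> \<nu> x" for v by (rule low)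
    then have "\<nu> (x + y) - \<nu> x \<le> \<mu> v + w (y - to_c00 v)" for v by (simp add: algebra_simps)
    then have "\<nu> (x + y) - \<nu> x \<le> \<nu> y" by (rule low)
    then show ?thesis by simp
  qed
  have lew: "\<nu> x \<le> w x" for x using up[of x 0] by (simp add: p to_c00_zero)
  have lip: "\<bar>\<nu> x - \<nu> y\<bar> \<le> w (x - y)" for x y
    using tri[of y "x - y"] tri[of x "y - x"] lew[of "x - y"] lew[of "y - x"] pw(5)[of "x - y"]
    by simp
  have ratle: "\<nu> (of_rat q *\<^sub>R x) \<le> \<bar>of_rat q\<bar> * \<nu> x" for q x
  proof (cases "q = 0")
    case True
    then show ?thesis using ext[of 0] by (simp add: to_c00_zero p)
  next
    case False
    then have q: "0 < \<bar>of_rat q :: real\<bar>" by simp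
    have "\<nu> (of_rat q *\<^sub>R x) / \<bar>of_rat q\<bar> \<le> \<nu> x"
    proof (rule low)
      fix v
      have "\<nu> (of_rat q *\<^sub>R x) \<le> \<mu> (qscale q v) + w (of_rat q *\<^sub>R (x - to_c00 v))"
        using up[of "of_rat q *\<^sub>R x" "qscale q v"] by (simp add: to_c00_qscale algebra_simps)
      also have "\<dots> = \<bar>of_rat q\<bar> * (\<mu> v + w (x - to_c00 v))"
        by (simp only: p(3) pw(3)) (simp add: algebra_simps)
      finally show "\<nu> (of_rat q *\<^sub>R x) / \<bar>of_rat q\<bar> \<le> \<mu> v + w (x - to_c00 v)"
        using q by (simp add: pos_divide_le_eq mult.commute)
    qed
    then show ?thesis using q by (simp add: pos_divide_le_eq mult.commute)
  qed
  have scale_le: "\<nu> (c *\<^sub>R x) \<le> \<bar>c\<bar> * \<nu> x" for c x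
  proof (rule field_le_epsilon)
    fix e :: real
    assume e: "0 < e"
    define d where "d = w x + \<nu> x + 1"
    have d: "0 < d" using pw(1)[of x] nn[of x] by (simp add: d_def)
    then obtain q where q: "\<bar>c - of_rat q\<bar> < e / d" using rat_approx[of "e / d" c] e by auto
    have "\<nu> (c *\<^sub>R x) \<le> \<nu> (of_rat q *\<^sub>R x) + w (c *\<^sub>R x - of_rat q *\<^sub>R x)"
      using lip[of "c *\<^sub>R x" "of_rat q *\<^sub>R x"] by linarith
    also have "w (c *\<^sub>R x - of_rat q *\<^sub>R x) = \<bar>c - of_rat q\<bar> * w x"
      using pw(3)[of "c - of_rat q" x] by (simp add: scaleR_diff_left)
    also have "\<nu> (of_rat q *\<^sub>R x) + \<bar>c - of_rat q\<bar> * w x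
        \<le> (\<bar>c\<bar> + \<bar>c - of_rat q\<bar>) * \<nu> x + \<bar>c - of_rat q\<bar> * w x"
    proof -
      have "\<bar>of_rat q\<bar> * \<nu> x \<le> (\<bar>c\<bar> + \<bar>c - of_rat q\<bar>) * \<nu> x"
        by (rule mult_right_mono[OF _ nn]) linarith
      then show ?thesis using ratle[of q x] by linarith
    qed
    also have "\<dots> \<le> \<bar>c\<bar> * \<nu> x + \<bar>c - of_rat q\<bar> * d"
      by (simp add: d_def algebra_simps)
    also have "\<bar>c - of_rat q\<bar> * d \<le> e"
      using iffD1[OF pos_less_divide_eq[OF d] q] by simp
    finally show "\<nu> (c *\<^sub>R x) \<le> \<bar>c\<bar> * \<nu> x + e" by simp
  qed
  have "\<nu> (c *\<^sub>R x) = \<bar>c\<bar> * \<nu> x" for c x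
  proof (cases "c = 0")
    case True
    then show ?thesis using ext[of 0] by (simp add: to_c00_zero p)
  next
    case False
    then show ?thesis
      using scale_le[of c x] scale_le[of "inverse c" "c *\<^sub>R x"]
      by (intro antisym) (auto simp: field_simps)
  qed
  then show ?thesis using nn tri ext unfolding pseudonorm_def by blast
qed

lemma extension:
  assumes "\<mu> \<in> PN"
  shows "pseudonorm (ext \<mu>)" "ext \<mu> (to_c00 v) = \<mu> v"
    "pseudonorm \<nu> \<Longrightarrow> (\<And>v. \<nu> (to_c00 v) = \<mu> v) \<Longrightarrow> \<nu> = ext \<mu>"
proof -
  have uniq: "\<nu> = \<nu>'"
    if "pseudonorm \<nu>" "\<And>v. \<nu> (to_c00 v) = \<mu> v" "pseudonorm \<nu>'" "\<And>v. \<nu>' (to_c00 v) = \<mu> v" for \<nu> \<nu>'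
  proof
    show "\<nu> x = \<nu>' x" for x by (rule extension_unique) (simp_all add: that)
  qed
  obtain \<nu>0 where "pseudonorm \<nu>0 \<and> (\<forall>v. \<nu>0 (to_c00 v) = \<mu> v)"
    using extension_exists[of \<mu>] assms by (auto simp: PN_def)
  then have "\<exists>!\<nu>. pseudonorm \<nu> \<and> (\<forall>v. \<nu> (to_c00 v) = \<mu> v)"
    by (intro ex1I[of _ \<nu>0]) (blast, rule uniq, auto)
  from theI'[OF this] show 1: "pseudonorm (ext \<mu>)" "ext \<mu> (to_c00 v) = \<mu> v" for v
    by (auto simp: ext_def)
  show "pseudonorm \<nu> \<Longrightarrow> (\<And>v. \<nu> (to_c00 v) = \<mu> v) \<Longrightarrow> \<nu> = ext \<mu>"
    by (rule uniq) (simp_all add: 1)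
qed


section \<open>Existence of the realization in \<open>\<ell>\<^sub>\<infinity>\<close>\<close>

definition sublin :: "('a::real_vector \<Rightarrow> real) \<Rightarrow> bool"
  where "sublin p \<longleftrightarrow> (\<forall>x y. p (x + y) \<le> p x + p y) \<and> (\<forall>t>0. \<forall>x. p (t *\<^sub>R x) \<le> t * p x)"

lemma sublinD:
  assumes "sublin p"
  shows "p (x + y) \<le> p x + p y" "t > 0 \<Longrightarrow> p (t *\<^sub>R x) = t * p x" "p 0 = 0" "- p (- x) \<le> p x"
proof -
  show 1: "p (x + y) \<le> p x + p y" for x y using assms by (auto simp: sublin_def)
  have 2: "t > 0 \<Longrightarrow> p (t *\<^sub>R x) \<le> t * p x" for t x using assms by (auto simp: sublin_def)
  show 3: "t > 0 \<Longrightarrow> p (t *\<^sub>R x) = t * p x" for t x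
    using 2[of t x] 2[of "inverse t" "t *\<^sub>R x"] by (intro antisym) (auto simp: field_simps)
  show 4: "p 0 = 0" using 3[of 2 0] by simp
  show "- p (- x) \<le> p x" using 1[of x "- x"] 4 by simp
qed

lemma sublin_pinch:
  fixes p :: "'a::real_vector \<Rightarrow> real"
  assumes "sublin p"
  shows "\<exists>q. sublin q \<and> (\<forall>x. q x \<le> p x) \<and> (\<forall>x. q x \<le> p (x + y) - p y)"
proof -
  note p = sublinD[OF assms]
  have p2: "p (t *\<^sub>R x) = t * p x" if "t \<ge> 0" for t x
    using that p(2,3) by (cases "t = 0") auto
  define q where "q x = (INF t\<in>{0..}. p (x + t *\<^sub>R y) - t * p y)" for x
  have bdd: "bdd_below ((\<lambda>t. p (x + t *\<^sub>R y) - t * p y) ` {0..})" for x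
  proof (rule bdd_belowI2)
    fix t :: real
    assume "t \<in> {0..}"
    then show "- p (- x) \<le> p (x + t *\<^sub>R y) - t * p y"
      using p(1)[of "x + t *\<^sub>R y" "- x"] p2[of t y] by simp
  qed
  have up: "t \<ge> 0 \<Longrightarrow> q x \<le> p (x + t *\<^sub>R y) - t * p y" for t x
    unfolding q_def by (rule cINF_lower[OF bdd]) simp
  have low: "(\<And>t. t \<ge> 0 \<Longrightarrow> b \<le> p (x + t *\<^sub>R y) - t * p y) \<Longrightarrow> b \<le> q x" for b x
    unfolding q_def by (rule cINF_greatest) auto
  have "q (x + z) \<le> q x + q z" for x z
  proof -
    have "q (x + z) - (p (z + s *\<^sub>R y) - s * p y) \<le> p (x + t *\<^sub>R y) - t * p y"
      if "t \<ge> 0" "s \<ge> 0" for s t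
      using up[of "t + s" "x + z"] p(1)[of "x + t *\<^sub>R y" "z + s *\<^sub>R y"] that
      by (simp add: algebra_simps)
    then have "q (x + z) - (p (z + s *\<^sub>R y) - s * p y) \<le> q x" if "s \<ge> 0" for s
      using that by (intro low)
    then have "q (x + z) - q x \<le> p (z + s *\<^sub>R y) - s * p y" if "s \<ge> 0" for s
      using that by (simp add: algebra_simps)
    then have "q (x + z) - q x \<le> q z" by (rule low)
    then show ?thesis by simp
  qed
  moreover have "q (s *\<^sub>R x) \<le> s * q x" if "s > 0" for s x
  proof -
    have "q (s *\<^sub>R x) / s \<le> q x"
    proof (rule low)
      fix t :: real
      assume "t \<ge> 0"
      then have "q (s *\<^sub>R x) \<le> p (s *\<^sub>R (x + t *\<^sub>R y)) - s * t * p y"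
        using up[of "s * t" "s *\<^sub>R x"] that by (simp add: algebra_simps)
      then show "q (s *\<^sub>R x) / s \<le> p (x + t *\<^sub>R y) - t * p y"
        unfolding pos_divide_le_eq[OF that] p(2)[OF that] by (simp add: algebra_simps)
    qed
    then show ?thesis using that by (simp add: pos_divide_le_eq mult.commute)
  qed
  ultimately have "sublin q" by (auto simp: sublin_def)
  moreover have "q x \<le> p x" for x using up[of 0 x] by simp
  moreover have "q x \<le> p (x + y) - p y" for x using up[of 1 x] by simp
  ultimately show ?thesis by blast
qed

lemma linear_below_sublin:
  fixes p :: "'a::real_vector \<Rightarrow> real"
  assumes "sublin p"
  shows "\<exists>f. linear f \<and> (\<forall>x. f x \<le> p x)"
proof -
  define A where "A = {q. sublin q \<and> (\<forall>x. q x \<le> p x)}"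
  define R where "R q r \<longleftrightarrow> (\<forall>x. r x \<le> q x)" for q r :: "'a \<Rightarrow> real"
  have "\<exists>m\<in>A. \<forall>q\<in>A. R m q \<longrightarrow> q = m"
  proof (rule predicate_Zorn)
    show "partial_order_on A (relation_of R A)"
      by (rule partial_order_on_relation_ofI)
        (auto simp: R_def fun_eq_iff intro: order_trans antisym)
    fix C
    assume C: "C \<in> Chains (relation_of R A)"
    then have CA: "C \<subseteq> A" and tot: "\<And>q r. q \<in> C \<Longrightarrow> r \<in> C \<Longrightarrow> R q r \<or> R r q"
      by (auto simp: Chains_def relation_of_def)
    show "\<exists>u\<in>A. \<forall>q\<in>C. R q u"
    proof (cases "C = {}")
      case True
      then show ?thesis using assms by (auto simp: A_def)
    next
      case False
      define g where "g x = (INF q\<in>C. q x)" for x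
      have bdd: "bdd_below ((\<lambda>q. q x) ` C)" for x
      proof (rule bdd_belowI2)
        fix q
        assume "q \<in> C"
        then have "sublin q" "q (- x) \<le> p (- x)" using CA by (auto simp: A_def)
        then show "- p (- x) \<le> q x" using sublinD(4)[of q x] by linarith
      qed
      have up: "q \<in> C \<Longrightarrow> g x \<le> q x" for q x unfolding g_def by (rule cINF_lower[OF bdd])
      have low: "(\<And>q. q \<in> C \<Longrightarrow> b \<le> q x) \<Longrightarrow> b \<le> g x" for b x
        unfolding g_def using False by (rule cINF_greatest)
      have sub: "q \<in> C \<Longrightarrow> sublin q" for q using CA by (auto simp: A_def)
      have "g (x + y) \<le> g x + g y" for x y
      proof -
        have *: "g (x + y) \<le> q x + r y" if qr: "q \<in> C" "r \<in> C" for q r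
        proof -
          obtain s where "s \<in> C" "s x \<le> q x" "s y \<le> r y"
            using tot[OF qr] qr by (auto simp: R_def)
          then show ?thesis using up[of s "x + y"] sublinD(1)[OF sub, of s x y] by linarith
        qed
        then have "g (x + y) - r y \<le> g x" if "r \<in> C" for r
          using that by (intro low) (simp add: algebra_simps)
        then have "g (x + y) - g x \<le> g y"
          by (intro low) (simp add: algebra_simps)
        then show ?thesis by simp
      qed
      moreover have "g (t *\<^sub>R x) \<le> t * g x" if "t > 0" for t x
      proof -
        have "g (t *\<^sub>R x) / t \<le> g x"
        proof (rule low)
          fix q
          assume "q \<in> C"
          then show "g (t *\<^sub>R x) / t \<le> q x"
            using up[of q "t *\<^sub>R x"] sublinD(2)[OF sub that, of q x] that
            by (simp add: pos_divide_le_eq mult.commute)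
        qed
        then show ?thesis using that by (simp add: pos_divide_le_eq mult.commute)
      qed
      moreover have "g x \<le> p x" for x
        using False CA up by (force simp: A_def intro: order_trans)
      ultimately have "g \<in> A" by (auto simp: A_def sublin_def)
      then show ?thesis using up by (auto simp: R_def)
    qed
  qed
  then obtain m where m: "sublin m" "\<And>x. m x \<le> p x"
    and min: "\<And>q. sublin q \<Longrightarrow> (\<And>x. q x \<le> m x) \<Longrightarrow> q = m"
    unfolding A_def R_def by (auto, metis order_trans)
  note M = sublinD[OF m(1)]
  have "m x + m y \<le> m (x + y)" for x y
  proof -
    obtain q where "sublin q" "\<And>x. q x \<le> m x" "\<And>x. q x \<le> m (x + y) - m y"
      using sublin_pinch[OF m(1), of y] by blast
    with min[of q] show ?thesis by (metis add_le_cancel_right diff_add_cancel)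
  qed
  then have add: "m (x + y) = m x + m y" for x y using M(1) by (intro antisym) auto
  have neg: "m (- x) = - m x" for x using add[of x "- x"] M(3) by simp
  have "m (c *\<^sub>R x) = c * m x" for c x
  proof (cases c "0::real" rule: linorder_cases)
    case less
    then show ?thesis using M(2)[of "- c" x] neg[of "c *\<^sub>R x"] by simp
  qed (use M in auto)
  with add have "linear m" by (intro linearI) auto
  with m(2) show ?thesis by blast
qed

lemma norming_functional:
  fixes \<nu> :: "'a::real_vector \<Rightarrow> real"
  assumes "pseudonorm \<nu>"
  shows "\<exists>f. linear f \<and> (\<forall>x. \<bar>f x\<bar> \<le> \<nu> x) \<and> f y = \<nu> y"
proof -
  note p = pseudonormD[OF assms]
  have "sublin \<nu>" using p by (auto simp: sublin_def)
  then obtain q where q: "sublin q" "\<And>x. q x \<le> \<nu> x" "\<And>x. q x \<le> \<nu> (x + y) - \<nu> y"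
    using sublin_pinch by blast
  obtain f where f: "linear f" "\<And>x. f x \<le> q x" using linear_below_sublin[OF q(1)] by blast
  have neg: "f (- x) = - f x" for x using f(1) by (rule linear_neg)
  have le: "f x \<le> \<nu> x" for x using f(2)[of x] q(2)[of x] by linarith
  have "\<bar>f x\<bar> \<le> \<nu> x" for x using le[of x] le[of "- x"] neg[of x] p(5)[of x] by linarith
  moreover have "f y = \<nu> y"
    using f(2)[of "- y"] q(3)[of "- y"] p(4) le[of y] neg[of y] by simp
  ultimately show ?thesis using f(1) by blast
qed

lemma enum_ratseq: "\<exists>e::nat \<Rightarrow> ratseq. surj e"
proof -
  have "\<exists>n. v = Poly_Mapping.nth (from_nat n)" for v :: ratseq
  proof -
    obtain N where N: "\<And>k. k \<in> Poly_Mapping.keys v \<Longrightarrow> k < N"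
      using finite_nat_bounded[OF finite_keys[of v]] by blast
    have "v = Poly_Mapping.nth (map (Poly_Mapping.lookup v) [0..<N])"
      by (rule poly_mapping_eqI)
        (use N in \<open>auto simp: nth.rep_eq nth_default_def in_keys_iff not_less[symmetric]\<close>)
    then show ?thesis by (metis from_nat_to_nat)
  qed
  then have "surj (\<lambda>n. Poly_Mapping.nth (from_nat n) :: ratseq)" by (metis surjI surj_def)
  then show ?thesis by blast
qed

lemma isometry_exists:
  assumes nu: "pseudonorm (\<nu> :: c00 \<Rightarrow> real)"
  shows "\<exists>T :: c00 \<Rightarrow> linfty. linear T \<and> (\<forall>x. norm (T x) = \<nu> x)"
proof -
  note p = pseudonormD[OF nu]
  obtain e :: "nat \<Rightarrow> ratseq" where e: "surj e" using enum_ratseq by blast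
  obtain f where f: "\<And>n. linear (f n)" "\<And>n x. \<bar>f n x\<bar> \<le> \<nu> x"
    "\<And>n. f n (to_c00 (e n)) = \<nu> (to_c00 (e n))"
  proof -
    have "\<exists>f. \<forall>n. linear (f n) \<and> (\<forall>x. \<bar>f n x\<bar> \<le> \<nu> x) \<and> f n (to_c00 (e n)) = \<nu> (to_c00 (e n))"
      by (rule choice) (use norming_functional[OF nu] in blast)
    then show ?thesis using that by blast
  qed
  define T :: "c00 \<Rightarrow> linfty" where "T x = Bcontfun (\<lambda>n. f (of_discrete n) x)" for x
  have "(\<lambda>n. f (of_discrete n) x) \<in> bcontfun" for x
    using f(2) by (auto simp: bcontfun_def bounded_iff continuous_on_open_vimage open_discrete)
  then have T: "apply_bcontfun (T x) n = f (of_discrete n) x" for x n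
    by (simp add: T_def Bcontfun_inverse)
  have lin: "linear T"
    by (rule linearI; rule bcontfun_eqI)
      (simp_all add: T linear_add[OF f(1)] linear_cmul[OF f(1)])
  have "norm (T x) = \<nu> x" for x
  proof (rule antisym)
    show "norm (T x) \<le> \<nu> x" by (rule norm_bound) (simp add: T f(2))
    show "\<nu> x \<le> norm (T x)"
    proof (rule field_le_epsilon)
      fix d :: real
      assume "0 < d"
      then obtain v where v: "\<nu> (x - to_c00 v) < d / 2"
        using to_c00_dense[OF nu, of "d / 2" x] by auto
      obtain n where n: "e n = v" using e by (metis surjD)
      have "\<nu> x \<le> \<nu> (to_c00 v) + \<nu> (x - to_c00 v)" by (rule p(7))
      also have "\<nu> (to_c00 v) = f n x - f n (x - to_c00 v)"
        using f(3)[of n] n linear_diff[OF f(1)[of n], of x "to_c00 v"] by simp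
      also have "\<dots> \<le> norm (T x) + \<nu> (x - to_c00 v)"
        using norm_bounded[of "T x" "discrete n"] f(2)[of n "x - to_c00 v"]
        by (simp add: T discrete_inverse)
      finally show "\<nu> x \<le> norm (T x) + d" using v by simp
    qed
  qed
  with lin show ?thesis by blast
qed

lemma canon:
  assumes "\<mu> \<in> PN"
  shows "linear (canon \<mu>)" "norm (canon \<mu> x) = ext \<mu> x"
  using someI_ex[OF isometry_exists[OF extension(1)[OF assms]]] by (auto simp: canon_def)

end

theory Submission
  imports Defs
begin

text \<open>
  A finite set of vectors close enough to a given finite independent set is its image under an
  isomorphism of the Banach space which is close to the identity: biorthogonal functionals give
  a perturbation of small norm. Hence finite-dimensional subspaces with good bases, and with
  bounded projections onto them, can be moved so as to be spanned by rational vectors, or so as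
  to contain exactly what they contained only approximately. Therefore \<open>X\<^sub>\<mu>\<close> has the local basis
  structure iff for some \<open>K\<close> and all \<open>n\<close> there are rational vectors, forming a basis with constant
  at most \<open>K\<close>, whose span contains rational \<open>1/(n+1)\<close>-approximations of the first \<open>n\<close> vectors of a dense
  sequence; for fixed data this is a closed condition on \<open>\<mu>\<close>, which gives \<open>\<Sigma>\<^sup>0\<^sub>4\<close>. By a compactness
  argument, a bounded projection onto the span exists iff for every \<open>N\<close> there is a bounded
  rational map on the span of the first \<open>N\<close> unit vectors which is a projection up to \<open>1/(N+1)\<close>; this
  adds two quantifiers.
\<close>

section \<open>Borel classes\<close>

text \<open>\<open>from_nat\<close> runs through the countable index type, possibly with
  repetitions, which a union does not notice. All pieces sit at the same level \<open>n\<close>;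
  \<open>1 <= n\<close> excludes the empty level 0.\<close>

lemma Sigma0_UN:
  fixes A :: "'i::countable \<Rightarrow> 'a set"
  assumes "1 \<le> n" "\<And>i. A i \<subseteq> topspace X" "\<And>i. Sigma0 X n (topspace X - A i)"
  shows "Sigma0 X (Suc n) (\<Union>i. A i)"
proof -
  have "(\<Union>i. A i) = (\<Union>k. A (from_nat k))"
    by (auto, metis from_nat_to_nat)
  moreover have "Sigma0 X (Suc n) (\<Union>k. A (from_nat k))"
    by (rule Sigma0_Union[where m = "\<lambda>_. n"]) (use assms in auto)
  ultimately show ?thesis by simp
qed

text \<open>De Morgan. Here and below, membership in a multiplicative class is expressed by saying
  that the complement lies in the additive one.\<close>

lemma Sigma0_compl_INT:
  fixes A :: "'i::countable \<Rightarrow> 'a set"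
  assumes "1 \<le> n" "\<And>i. A i \<subseteq> topspace X" "\<And>i. Sigma0 X n (A i)"
  shows "Sigma0 X (Suc n) (topspace X - (\<Inter>i. A i))"
proof -
  have "topspace X - (\<Inter>i. A i) = (\<Union>i. topspace X - A i)" by auto
  moreover have "Sigma0 X (Suc n) (\<Union>i. topspace X - A i)"
    by (rule Sigma0_UN) (use assms in \<open>auto simp: double_diff\<close>)
  ultimately show ?thesis by simp
qed


section \<open>Perturbation of finite independent sets\<close>

text \<open>Induction on the set. The functionals for \<open>B\<close> give a bounded projection
  \<open>P\<close> onto \<open>span B\<close>. A norming functional of \<open>b - P b\<close>,
  applied to \<open>x - P x\<close> and rescaled, vanishes on \<open>B\<close> and is 1 at
  \<open>b\<close>; subtracting a multiple of it makes the old functionals vanish at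
  \<open>b\<close>.\<close>

lemma biorthogonal_functionals:
  fixes B :: "'a::real_normed_vector set"
  assumes "finite B" "independent B"
  shows "\<exists>g. (\<forall>b. bounded_linear (g b)) \<and>
    (\<forall>b\<in>B. \<forall>c\<in>B. g b c = (if b = c then 1 else (0::real)))"
  using assms
proof (induction B rule: finite_induct)
  case empty
  show ?case by (rule exI[of _ "\<lambda>_ _. 0"]) auto
next
  case (insert b B)
  have "independent B" and nb: "b \<notin> span B"
    using insert.prems insert.hyps by (auto simp: independent_insert)
  then obtain g where g: "\<And>b. bounded_linear (g b)"
    "\<And>b c. b \<in> B \<Longrightarrow> c \<in> B \<Longrightarrow> g b c = (if b = c then 1 else (0::real))"
    using insert.IH by blast
  define P where "P x = (\<Sum>c\<in>B. g c x *\<^sub>R c)" for x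
  have P: "bounded_linear P"
    unfolding P_def
    by (intro bounded_linear_sum bounded_linear_scaleR_const g)
  have Pc: "P c = c" if "c \<in> B" for c
  proof -
    have "P c = (\<Sum>d\<in>B. if d = c then d else 0)"
      unfolding P_def by (rule sum.cong) (use g(2) that in auto)
    then show ?thesis using that insert.hyps(1) by simp
  qed
  define z where "z = b - P b"
  have "P b \<in> span B"
    unfolding P_def by (intro span_sum span_scale span_base)
  then have z: "z \<noteq> 0" using nb by (auto simp: z_def)
  have "pseudonorm (norm :: 'a \<Rightarrow> real)"
    by (auto simp: pseudonorm_def norm_triangle_ineq)
  from norming_functional[OF this, of z] obtain f :: "'a \<Rightarrow> real"
    where f: "linear f" "\<And>x. \<bar>f x\<bar> \<le> norm x" "f z = norm z" by blast
  have bf: "bounded_linear f"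
    using f by (intro bounded_linear_intro[where K = 1]) (auto simp: linear_add linear_cmul)
  define h where "h x = f (x - P x) / norm z" for x
  have bh: "bounded_linear h"
    unfolding h_def divide_inverse
    by (intro bounded_linear_mult_const bounded_linear_compose[OF bf] bounded_linear_sub
        bounded_linear_ident P)
  have hb: "h b = 1" using f(3) z by (simp add: h_def z_def)
  have hc: "h c = 0" if "c \<in> B" for c
    using Pc[OF that] linear_0[OF f(1)] by (simp add: h_def)
  define g' where "g' c = (if c = b then h else (\<lambda>x. g c x - h x * g c b))" for c
  have "bounded_linear (g' c)" for c
    unfolding g'_def using bh g(1)
    by (auto intro!: bounded_linear_sub bounded_linear_mult_const)
  moreover have "g' c d = (if c = d then 1 else 0)" if "c \<in> insert b B" "d \<in> insert b B" for c d
    using that hb hc g(2) insert.hyps(2) by (auto simp: g'_def)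
  ultimately show ?case by blast
qed

text \<open>The biorthogonal functional of \<open>xs ! i\<close> isolates \<open>a i\<close>. The
  sum of the operator norms is one constant that serves all lengths \<open>m\<close> and all indices
  \<open>i\<close>.\<close>

lemma coefficient_bound:
  fixes xs :: "'a::real_normed_vector list"
  assumes "distinct xs" "independent (set xs)"
  shows "\<exists>C\<ge>0. \<forall>a m i. i < m \<and> m \<le> length xs \<longrightarrow>
    \<bar>a i\<bar> \<le> C * norm (\<Sum>j<m. a j *\<^sub>R xs ! j)"
proof -
  obtain g where g: "\<And>b. bounded_linear (g b)"
    "\<And>b c. b \<in> set xs \<Longrightarrow> c \<in> set xs \<Longrightarrow> g b c = (if b = c then 1 else (0::real))"
    using biorthogonal_functionals[OF _ assms(2)] by auto
  define C where "C = (\<Sum>b\<in>set xs. onorm (g b))"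
  have on: "0 \<le> onorm (g b)" for b by (rule onorm_pos_le[OF g(1)])
  have "\<bar>a i\<bar> \<le> C * norm (\<Sum>j<m. a j *\<^sub>R xs ! j)" if im: "i < m" "m \<le> length xs" for a m i
  proof -
    let ?s = "\<Sum>j<m. a j *\<^sub>R xs ! j"
    have "g (xs ! i) ?s = (\<Sum>j<m. a j * g (xs ! i) (xs ! j))"
      using bounded_linear.linear[OF g(1), of "xs ! i"] by (simp add: linear_sum linear_cmul)
    also have "\<dots> = (\<Sum>j<m. if j = i then a j else 0)"
      by (rule sum.cong) (use im assms(1) g(2) in \<open>auto simp: nth_eq_iff_index_eq\<close>)
    also have "\<dots> = a i" using im by simp
    finally have "\<bar>a i\<bar> \<le> onorm (g (xs ! i)) * norm ?s"
      using onorm[OF g(1), of "xs ! i" ?s] by simp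
    also have "\<dots> \<le> C * norm ?s"
      unfolding C_def by (intro mult_right_mono member_le_sum) (use im on in auto)
    finally show ?thesis .
  qed
  moreover have "0 \<le> C" unfolding C_def by (intro sum_nonneg on)
  ultimately show ?thesis by blast
qed

text \<open>Injectivity follows from the norm estimate. A solution of \<open>y = x + A x\<close> is
  a fixed point of the contraction that sends \<open>x\<close> to \<open>y - A x\<close>.\<close>

lemma bij_identity_plus_contraction:
  fixes A :: "'a::banach \<Rightarrow> 'a"
  assumes lin: "linear A" and le: "\<And>x. norm (A x) \<le> e * norm x" and e: "0 \<le> e" "e < 1"
  shows "bij (\<lambda>x. x + A x)"
proof (rule bijI)
  show "inj (\<lambda>x. x + A x)"
  proof (rule injI)
    fix x y assume "x + A x = y + A y"
    then have "x - y = A (y - x)" by (simp add: linear_diff[OF lin] algebra_simps)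
    then have "norm (x - y) \<le> e * norm (x - y)" using le[of "y - x"] by (simp add: norm_minus_commute)
    then have "(1 - e) * norm (x - y) \<le> 0" by (simp add: algebra_simps)
    then show "x = y" using e by (simp add: mult_le_0_iff)
  qed
  have "\<exists>x. y = x + A x" for y
  proof -
    have "dist (y - A x) (y - A z) \<le> e * dist x z" for x z
      using le[of "z - x"] by (simp add: dist_norm linear_diff[OF lin] norm_minus_commute)
    then have "\<exists>!x. y - A x = x" by (intro banach_fix_type[OF e]) blast
    then show ?thesis by (metis add.commute diff_add_cancel)
  qed
  then show "surj (\<lambda>x. x + A x)" by (simp add: surj_def)
qed

text \<open>The last clause makes \<open>S\<close> restrict to a bijection of \<open>X\<close>, so
  that projections, which are controlled on \<open>X\<close> only, can be conjugated by
  \<open>S\<close>.\<close>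

definition near_identity :: "real \<Rightarrow> 'a::real_normed_vector set \<Rightarrow> ('a \<Rightarrow> 'a) \<Rightarrow> bool"
  where "near_identity e X S \<longleftrightarrow> linear S \<and> bij S \<and>
    (\<forall>x. norm (S x - x) \<le> e * norm x) \<and> (\<forall>x. S x \<in> X \<longleftrightarrow> x \<in> X)"

text \<open>\<open>S\<close> is the identity plus the finite-rank map \<open>A\<close> that sends
  each \<open>b\<close> to \<open>u b - b\<close>; the biorthogonal functionals keep the norm of
  \<open>A\<close> below \<open>e\<close>. Since \<open>A\<close> takes values in \<open>X\<close>,
  membership in \<open>X\<close> is preserved in both directions. The tolerance depends on
  \<open>B\<close> and \<open>e\<close>, not on \<open>u\<close>.\<close>

lemma perturbation:
  fixes X :: "'a::banach set"
  assumes X: "subspace X" and B: "finite B" "independent B" "B \<subseteq> X" and e: "0 < e" "e < 1"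
  shows "\<exists>\<delta>>0. \<forall>u. (\<forall>b\<in>B. u b \<in> X \<and> norm (u b - b) \<le> \<delta>) \<longrightarrow>
    (\<exists>S. near_identity e X S \<and> (\<forall>b\<in>B. S b = u b))"
proof -
  obtain g where g: "\<And>b. bounded_linear (g b)"
    "\<And>b c. b \<in> B \<Longrightarrow> c \<in> B \<Longrightarrow> g b c = (if b = c then 1 else (0::real))"
    using biorthogonal_functionals[OF B(1,2)] by blast
  define C where "C = (\<Sum>b\<in>B. onorm (g b))"
  have on: "0 \<le> onorm (g b)" for b by (rule onorm_pos_le[OF g(1)])
  have C: "0 \<le> C" unfolding C_def by (intro sum_nonneg on)
  define \<delta> where "\<delta> = e / (1 + C)"
  have "\<exists>S. near_identity e X S \<and> (\<forall>b\<in>B. S b = u b)"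
    if u: "\<forall>b\<in>B. u b \<in> X \<and> norm (u b - b) \<le> \<delta>" for u
  proof -
    define A where "A x = (\<Sum>b\<in>B. g b x *\<^sub>R (u b - b))" for x
    have "bounded_linear A"
      unfolding A_def by (intro bounded_linear_sum bounded_linear_scaleR_const g)
    then have lin: "linear A" by (rule bounded_linear.linear)
    have le: "norm (A x) \<le> e * norm x" for x
    proof -
      have "norm (A x) \<le> (\<Sum>b\<in>B. (onorm (g b) * norm x) * \<delta>)"
        unfolding A_def
      proof (rule sum_norm_le)
        fix b assume b: "b \<in> B"
        have "\<bar>g b x\<bar> \<le> onorm (g b) * norm x" using onorm[OF g(1), of b x] by simp
        then show "norm (g b x *\<^sub>R (u b - b)) \<le> (onorm (g b) * norm x) * \<delta>"
          using u b on by (auto intro!: mult_mono)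
      qed
      also have "\<dots> = (C * \<delta>) * norm x"
        by (simp add: C_def sum_distrib_left sum_distrib_right mult_ac)
      also have "\<dots> \<le> e * norm x"
        using C e by (intro mult_right_mono) (auto simp: \<delta>_def field_simps)
      finally show ?thesis .
    qed
    have AX: "A x \<in> X" for x
      unfolding A_def using u B(3) by (auto intro!: subspace_sum subspace_scale subspace_diff X)
    have "A b = u b - b" if "b \<in> B" for b
    proof -
      have "A b = (\<Sum>c\<in>B. if c = b then u c - c else 0)"
        unfolding A_def by (rule sum.cong) (use g(2) that in auto)
      then show ?thesis using that B(1) by simp
    qed
    moreover have "near_identity e X (\<lambda>x. x + A x)"
      unfolding near_identity_def
    proof (intro conjI allI)
      show "linear (\<lambda>x. x + A x)" by (intro linear_compose_add linear_ident lin)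
      show "bij (\<lambda>x. x + A x)"
        by (rule bij_identity_plus_contraction[OF lin le]) (use e in auto)
      show "norm (x + A x - x) \<le> e * norm x" for x using le by simp
      show "(x + A x \<in> X) = (x \<in> X)" for x
        using subspace_add[OF X, of x "A x"] subspace_diff[OF X, of "x + A x" "A x"] AX[of x] by auto
    qed
    ultimately show ?thesis by (intro exI[of _ "\<lambda>x. x + A x"]) auto
  qed
  moreover have "0 < \<delta>" using C e by (simp add: \<delta>_def)
  ultimately show ?thesis by blast
qed


section \<open>Bases with a given bound\<close>

definition basis_bound :: "real \<Rightarrow> 'a::real_normed_vector list \<Rightarrow> bool"
  where "basis_bound C xs \<longleftrightarrow> (\<forall>n m a. n \<le> m \<and> m \<le> length xs \<longrightarrow>
      norm (\<Sum>i<n. a i *\<^sub>R xs ! i) \<le> C * norm (\<Sum>i<m. a i *\<^sub>R xs ! i))"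

lemma basis_bound_mono: "basis_bound C xs \<Longrightarrow> C \<le> D \<Longrightarrow> basis_bound D xs"
  unfolding basis_bound_def by (meson mult_right_mono norm_ge_zero order_trans)

text \<open>Shows that \<open>basis_const\<close> minimises over a nonempty set: each coefficient of
  the shorter sum is controlled by the norm of the longer one.\<close>

lemma basis_bound_exists:
  fixes xs :: "'a::real_normed_vector list"
  assumes "distinct xs" "independent (set xs)"
  shows "\<exists>C\<ge>1. basis_bound C xs"
proof -
  obtain C where C: "C \<ge> 0" "\<And>a m i. i < m \<Longrightarrow> m \<le> length xs \<Longrightarrow>
    \<bar>a i\<bar> \<le> C * norm (\<Sum>j<m. a j *\<^sub>R xs ! j)"
    using coefficient_bound[OF assms] by blast
  let ?D = "1 + (\<Sum>i<length xs. C * norm (xs ! i))"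
  have "norm (\<Sum>i<n. a i *\<^sub>R xs ! i) \<le> ?D * norm (\<Sum>i<m. a i *\<^sub>R xs ! i)"
    if nm: "n \<le> m" "m \<le> length xs" for n m a
  proof -
    let ?s = "\<Sum>i<m. a i *\<^sub>R xs ! i"
    have "norm (\<Sum>i<n. a i *\<^sub>R xs ! i) \<le> (\<Sum>i<n. (C * norm ?s) * norm (xs ! i))"
      by (rule sum_norm_le) (use C(2)[of _ m a] nm in \<open>auto intro!: mult_right_mono\<close>)
    also have "\<dots> \<le> (\<Sum>i<length xs. (C * norm ?s) * norm (xs ! i))"
      by (rule sum_mono2) (use nm C(1) in auto)
    also have "\<dots> = (\<Sum>i<length xs. C * norm (xs ! i)) * norm ?s"
      by (simp add: sum_distrib_left sum_distrib_right mult_ac)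
    also have "\<dots> \<le> ?D * norm ?s" by (simp add: algebra_simps)
    finally show ?thesis .
  qed
  moreover have "?D \<ge> 1" using C(1) by (simp add: sum_nonneg)
  ultimately show ?thesis unfolding basis_bound_def by blast
qed

text \<open>The \<open>LEAST\<close> is attained because the infimum of the admissible constants is
  admissible: divide by the right-hand norm and pass to the infimum. If that norm is zero, any
  admissible constant forces the left side to vanish.\<close>

lemma basis_const:
  fixes xs :: "'a::real_normed_vector list"
  assumes "distinct xs" "independent (set xs)"
  shows "1 \<le> basis_const xs" "basis_bound (basis_const xs) xs"
    "\<And>C. 1 \<le> C \<Longrightarrow> basis_bound C xs \<Longrightarrow> basis_const xs \<le> C"
proof -
  define S where "S = {C. 1 \<le> C \<and> basis_bound C xs}"
  have ne: "S \<noteq> {}" using basis_bound_exists[OF assms] by (auto simp: S_def)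
  have bdd: "bdd_below S" by (rule bdd_belowI[of _ 1]) (auto simp: S_def)
  have low: "\<And>C. C \<in> S \<Longrightarrow> Inf S \<le> C" by (rule cInf_lower[OF _ bdd])
  have "1 \<le> Inf S" by (rule cInf_greatest[OF ne]) (auto simp: S_def)
  moreover have "basis_bound (Inf S) xs"
    unfolding basis_bound_def
  proof (intro allI impI)
    fix n m a assume nm: "n \<le> m \<and> m \<le> length xs"
    let ?A = "norm (\<Sum>i<n. a i *\<^sub>R xs ! i)" and ?B = "norm (\<Sum>i<m. a i *\<^sub>R xs ! i)"
    have le: "?A \<le> C * ?B" if "C \<in> S" for C
      using that nm by (auto simp: S_def basis_bound_def)
    show "?A \<le> Inf S * ?B"
    proof (cases "?B = 0")
      case True
      then show ?thesis using le ne by fastforce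
    next
      case False
      then have B: "?B > 0" by simp
      have "?A / ?B \<le> Inf S"
        by (rule cInf_greatest[OF ne]) (use le B in \<open>simp add: pos_divide_le_eq\<close>)
      then show ?thesis using B by (simp add: pos_divide_le_eq)
    qed
  qed
  ultimately have "Inf S \<in> S" by (simp add: S_def)
  have "basis_const xs = (LEAST C. C \<in> S)"
    by (simp add: basis_const_def S_def basis_bound_def)
  also have "\<dots> = Inf S" using \<open>Inf S \<in> S\<close> low by (rule Least_equality)
  finally show "1 \<le> basis_const xs" "basis_bound (basis_const xs) xs"
    "\<And>C. 1 \<le> C \<Longrightarrow> basis_bound C xs \<Longrightarrow> basis_const xs \<le> C"
    using \<open>Inf S \<in> S\<close> low by (auto simp: S_def)
qed

lemma bc_le:
  assumes "is_basis E xs" "1 \<le> C" "basis_bound C xs"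
  shows "bc E \<le> C"
proof -
  have "bc E \<le> basis_const xs"
    unfolding bc_def
    by (rule cInf_lower) (use assms(1) basis_const(1) in \<open>auto simp: is_basis_def intro!: bdd_belowI2[where m = 1]\<close>)
  also have "\<dots> \<le> C" using basis_const(3) assms by (auto simp: is_basis_def)
  finally show ?thesis .
qed

text \<open>A finite spanning set contains a basis, so the infimum runs over a nonempty set; the
  strict inequality avoids the question whether it is attained.\<close>

lemma basis_bound_of_bc_less:
  assumes "fin_dim_subspace E" "bc E < C"
  shows "\<exists>xs. is_basis E xs \<and> basis_bound C xs"
proof -
  obtain S where S: "finite S" "span S = E" using assms(1) by (auto simp: fin_dim_subspace_def)
  obtain B where B: "B \<subseteq> S" "independent B" "S \<subseteq> span B"
    using maximal_independent_subset[of S] by blast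
  then obtain xs where xs: "set xs = B" "distinct xs"
    using finite_distinct_list finite_subset[OF B(1) S(1)] by blast
  have "span B = E" using S B span_minimal[OF B(3)] span_mono[OF B(1)] by auto
  then have "is_basis E xs" using xs B by (simp add: is_basis_def)
  then have "basis_const ` {xs. is_basis E xs} \<noteq> {}" by blast
  from cInf_lessD[OF this] assms(2) obtain ys where ys: "is_basis E ys" "basis_const ys < C"
    unfolding bc_def by blast
  have "basis_bound (basis_const ys) ys"
    using ys(1) by (intro basis_const) (auto simp: is_basis_def)
  then have "basis_bound C ys" using ys(2) basis_bound_mono less_imp_le by blast
  then show ?thesis using ys(1) by blast
qed

section \<open>Good bases and their transport by isomorphisms\<close>

definition bounded_basis :: "real \<Rightarrow> 'a::real_normed_vector set \<Rightarrow> 'a list \<Rightarrow> bool"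
  where "bounded_basis K X xs \<longleftrightarrow>
    distinct xs \<and> independent (set xs) \<and> set xs \<subseteq> X \<and> basis_bound K xs"

definition bounded_proj :: "real \<Rightarrow> 'a::real_normed_vector set \<Rightarrow> 'a set \<Rightarrow> bool"
  where "bounded_proj K X E \<longleftrightarrow> (\<exists>Q. linear_proj X E Q \<and> (\<forall>x\<in>X. norm (Q x) \<le> K * norm x))"

text \<open>
  The flag \<open>\<pi>\<close> selects between the two local structures: the projections are
  required if and only if it is set.
\<close>

definition good :: "bool \<Rightarrow> real \<Rightarrow> 'a::real_normed_vector set \<Rightarrow> 'a list \<Rightarrow> bool"
  where "good \<pi> K X xs \<longleftrightarrow>
    bounded_basis K X xs \<and> (\<pi> \<longrightarrow> bounded_proj K X (span (set xs)))"

definition local_structure :: "bool \<Rightarrow> 'a::banach set \<Rightarrow> bool"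
  where "local_structure \<pi> X \<longleftrightarrow> (if \<pi> then LPBS X else LBS X)"

lemma good_mono:
  assumes "good \<pi> K X xs" "K \<le> L"
  shows "good \<pi> L X xs"
proof -
  have "norm y \<le> K * norm x \<Longrightarrow> norm y \<le> L * norm x" for x y :: 'a
    using assms(2) by (meson mult_right_mono norm_ge_zero order_trans)
  then show ?thesis
    using assms basis_bound_mono unfolding good_def bounded_basis_def bounded_proj_def by blast
qed

lemma linear_inv:
  fixes S :: "'a::real_vector \<Rightarrow> 'b::real_vector"
  assumes "linear S" "bij S"
  shows "linear (inv S)"
proof -
  have "S (inv S x) = x" for x using assms(2) by (simp add: bij_is_surj surj_f_inv_f)
  then show ?thesis
    using assms by (intro linearI; intro inv_f_eq bij_is_inj) (simp_all add: linear_add linear_cmul)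
qed

text \<open>Bases are mapped by \<open>S\<close> and projections are conjugated by it. Each estimate
  costs one factor \<open>c\<close> for \<open>S\<close> and one factor \<open>d\<close> for its
  inverse, together at most 2. The two-sided bounds let the lemma serve \<open>S\<close> and its
  inverse alike.\<close>

lemma good_image:
  fixes S :: "'a::real_normed_vector \<Rightarrow> 'a"
  assumes lin: "linear S" and bij: "bij S" and X: "\<And>x. S x \<in> X \<longleftrightarrow> x \<in> X" "subspace X"
    and c: "\<And>x. norm (S x) \<le> c * norm x" and d: "\<And>x. norm x \<le> d * norm (S x)"
    and cd: "0 \<le> c" "0 \<le> d" "c * d \<le> 2" and K: "0 \<le> K"
    and good: "good \<pi> K X xs"
  shows "good \<pi> (2 * K) X (map S xs)"
proof -
  have inj: "inj S" using bij by (rule bij_is_inj)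
  have cK: "c * (K * (d * t)) \<le> 2 * K * t" if "0 \<le> t" for t
  proof -
    have "c * (K * (d * t)) = (c * d) * (K * t)" by (simp add: mult_ac)
    also have "\<dots> \<le> 2 * (K * t)" using cd(3) K that by (intro mult_right_mono) auto
    finally show ?thesis by (simp add: mult_ac)
  qed
  have xs: "distinct xs" "independent (set xs)" "set xs \<subseteq> X" "basis_bound K xs"
    using good by (auto simp: good_def bounded_basis_def)
  have "distinct (map S xs)" using xs(1) inj by (simp add: distinct_map inj_on_def)
  moreover have "independent (set (map S xs))"
    using linear_independent_injective_image[OF lin xs(2)] inj by (simp add: inj_on_subset)
  moreover have "set (map S xs) \<subseteq> X" using xs(3) X(1) by auto
  moreover have "basis_bound (2 * K) (map S xs)"
    unfolding basis_bound_def
  proof (intro allI impI)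
    fix n m a assume nm: "n \<le> m \<and> m \<le> length (map S xs)"
    have S: "(\<Sum>i<k. a i *\<^sub>R map S xs ! i) = S (\<Sum>i<k. a i *\<^sub>R xs ! i)" if "k \<le> length xs" for k
      using that by (simp add: linear_sum[OF lin] linear_cmul[OF lin])
    let ?s = "\<Sum>i<m. a i *\<^sub>R xs ! i"
    have "norm (S (\<Sum>i<n. a i *\<^sub>R xs ! i)) \<le> c * norm (\<Sum>i<n. a i *\<^sub>R xs ! i)" by (rule c)
    also have "\<dots> \<le> c * (K * norm ?s)"
      using xs(4) nm cd by (intro mult_left_mono) (auto simp: basis_bound_def)
    also have "\<dots> \<le> c * (K * (d * norm (S ?s)))"
      using cd K d by (intro mult_left_mono) auto
    also have "\<dots> \<le> 2 * K * norm (S ?s)" by (rule cK) simp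
    finally show "norm (\<Sum>i<n. a i *\<^sub>R map S xs ! i) \<le> 2 * K * norm (\<Sum>i<m. a i *\<^sub>R map S xs ! i)"
      using S nm by simp
  qed
  moreover have "bounded_proj (2 * K) X (span (set (map S xs)))" if pi: \<pi>
  proof -
    obtain Q where Q: "linear_proj X (span (set xs)) Q" "\<And>x. x \<in> X \<Longrightarrow> norm (Q x) \<le> K * norm x"
      using good pi by (auto simp: good_def bounded_proj_def)
    have Q': "\<And>x y. x \<in> X \<Longrightarrow> y \<in> X \<Longrightarrow> Q (x + y) = Q x + Q y"
      "\<And>c x. x \<in> X \<Longrightarrow> Q (c *\<^sub>R x) = c *\<^sub>R Q x" "Q ` X = span (set xs)"
      "\<And>x. x \<in> X \<Longrightarrow> Q (Q x) = Q x"
      using Q(1) by (auto simp: linear_proj_def)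
    define R where "R = inv S"
    have R: "linear R" unfolding R_def by (rule linear_inv[OF lin bij])
    have SR: "S (R x) = x" and RS: "R (S x) = x" for x
      unfolding R_def using bij by (simp_all add: bij_is_surj surj_f_inv_f inj)
    have RX: "R x \<in> X \<longleftrightarrow> x \<in> X" for x using X(1)[of "R x"] SR by simp
    have RXim: "R ` X = X" using RX RS X(1) by (auto, metis imageI)
    define P where "P x = S (Q (R x))" for x
    have "linear_proj X (span (set (map S xs))) P"
      unfolding linear_proj_def
    proof (intro conjI ballI allI)
      show "P (x + y) = P x + P y" if "x \<in> X" "y \<in> X" for x y
        using that RX by (simp add: P_def linear_add[OF R] linear_add[OF lin] Q'(1))
      show "P (c *\<^sub>R x) = c *\<^sub>R P x" if "x \<in> X" for c x
        using that RX by (simp add: P_def linear_cmul[OF R] linear_cmul[OF lin] Q'(2))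
      have "P ` X = S ` Q ` R ` X" by (auto simp: P_def)
      then show "P ` X = span (set (map S xs))"
        by (simp add: RXim Q'(3) linear_span_image[OF lin])
      show "P (P x) = P x" if "x \<in> X" for x
        using that RX Q'(4) by (simp add: P_def RS)
    qed
    moreover have "norm (P x) \<le> 2 * K * norm x" if "x \<in> X" for x
    proof -
      have "norm (P x) \<le> c * norm (Q (R x))" unfolding P_def by (rule c)
      also have "\<dots> \<le> c * (K * norm (R x))"
        using Q(2) RX that cd by (intro mult_left_mono) auto
      also have "\<dots> \<le> c * (K * (d * norm x))"
        using d[of "R x"] cd K by (intro mult_left_mono) (auto simp: SR)
      also have "\<dots> \<le> 2 * K * norm x" by (rule cK) simp
      finally show ?thesis .
    qed
    ultimately show ?thesis unfolding bounded_proj_def by blast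
  qed
  ultimately show ?thesis by (auto simp: good_def bounded_basis_def)
qed

text \<open>With \<open>1/3\<close> the two constants multiply to exactly 2, the loss allowed in
  \<open>good_image\<close>.\<close>

lemma near_identity_norm:
  assumes "near_identity (1/3) X S"
  shows "norm (S x) \<le> 4/3 * norm x" "norm x \<le> 3/2 * norm (S x)"
proof -
  have "norm (S x - x) \<le> norm x / 3" using assms by (auto simp: near_identity_def)
  then show "norm (S x) \<le> 4/3 * norm x" "norm x \<le> 3/2 * norm (S x)"
    using norm_triangle_ineq[of "S x - x" x] norm_triangle_ineq2[of x "S x"]
    by (simp_all add: norm_minus_commute)
qed

lemma good_near_identity:
  assumes "near_identity (1/3) X S" "subspace X" "0 \<le> K" "good \<pi> K X xs"
  shows "good \<pi> (2 * K) X (map S xs)"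
  by (rule good_image[where c = "4/3" and d = "3/2"])
    (use assms near_identity_norm[OF assms(1)] in \<open>auto simp: near_identity_def\<close>)

lemma good_near_identity_inv:
  assumes S: "near_identity (1/3) X S" and "subspace X" "0 \<le> K" "good \<pi> K X xs"
  shows "good \<pi> (2 * K) X (map (inv S) xs)"
proof -
  have lin: "linear S" and bij: "bij S" and X: "\<And>x. S x \<in> X \<longleftrightarrow> x \<in> X"
    using S by (auto simp: near_identity_def)
  have SR: "S (inv S x) = x" for x using bij by (simp add: bij_is_surj surj_f_inv_f)
  show ?thesis
  proof (rule good_image[where c = "3/2" and d = "4/3"])
    show "linear (inv S)" by (rule linear_inv[OF lin bij])
    show "bij (inv S)" using bij by (rule bij_imp_bij_inv)
    show "inv S x \<in> X \<longleftrightarrow> x \<in> X" for x using X[of "inv S x"] by (simp add: SR)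
    show "norm (inv S x) \<le> 3/2 * norm x" "norm x \<le> 4/3 * norm (inv S x)" for x
      using near_identity_norm[OF S, of "inv S x"] by (simp_all add: SR)
  qed (use assms in auto)
qed

text \<open>The tolerance is fixed by a maximal independent \<open>B\<close> in \<open>A\<close>
  before \<open>xs\<close> is chosen. The isomorphism \<open>S\<close> moves \<open>B\<close> into
  the span of \<open>xs\<close>, so pulling \<open>xs\<close> back by the inverse gives a span that
  contains \<open>B\<close>, hence \<open>A\<close>, exactly.\<close>

lemma good_absorb_finite:
  fixes X :: "'a::banach set"
  assumes X: "subspace X" and K: "0 \<le> K"
    and appr: "\<And>A \<delta>. finite A \<Longrightarrow> A \<subseteq> X \<Longrightarrow> 0 < \<delta> \<Longrightarrow>
      \<exists>xs. good \<pi> K X xs \<and> (\<forall>a\<in>A. \<exists>y\<in>span (set xs). norm (a - y) \<le> \<delta>)"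
    and A: "finite A" "A \<subseteq> X"
  shows "\<exists>xs. good \<pi> (2 * K) X xs \<and> A \<subseteq> span (set xs)"
proof -
  obtain B where B: "B \<subseteq> A" "independent B" "A \<subseteq> span B"
    using maximal_independent_subset[of A] by blast
  have fB: "finite B" and BX: "B \<subseteq> X" using B A finite_subset by auto
  obtain \<delta> where \<delta>: "\<delta> > 0" "\<And>u. (\<forall>b\<in>B. u b \<in> X \<and> norm (u b - b) \<le> \<delta>) \<Longrightarrow>
    (\<exists>S. near_identity (1/3) X S \<and> (\<forall>b\<in>B. S b = u b))"
    using perturbation[OF X fB B(2) BX, of "1/3"] by auto
  obtain xs where xs: "good \<pi> K X xs" "\<And>b. b \<in> B \<Longrightarrow> \<exists>y\<in>span (set xs). norm (b - y) \<le> \<delta>"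
    using appr[OF fB BX \<delta>(1)] by blast
  have sX: "span (set xs) \<subseteq> X"
    using xs(1) X by (intro span_minimal) (auto simp: good_def bounded_basis_def)
  obtain u where u: "\<And>b. b \<in> B \<Longrightarrow> u b \<in> span (set xs) \<and> norm (b - u b) \<le> \<delta>"
    using xs(2) by metis
  obtain S where S: "near_identity (1/3) X S" "\<And>b. b \<in> B \<Longrightarrow> S b = u b"
    using \<delta>(2)[of u] u sX by (metis norm_minus_commute subsetD)
  have lin: "linear S" and bij: "bij S" using S by (auto simp: near_identity_def)
  let ?ys = "map (inv S) xs"
  have "S ` span (set ?ys) = span (set xs)"
    using bij by (simp add: linear_span_image[OF lin, symmetric] image_image bij_is_surj surj_f_inv_f)
  then have "b \<in> span (set ?ys)" if "b \<in> B" for b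
    using u[OF that] S(2)[OF that] bij_is_inj[OF bij] by (metis image_iff injD)
  then have "span B \<subseteq> span (set ?ys)" by (intro span_minimal) auto
  then show ?thesis using good_near_identity_inv[OF S(1) X K xs(1)] B(3) by blast
qed


section \<open>Local structures in terms of finite sets\<close>

text \<open>The chain increases to a dense union, so a single member \<open>E N\<close> comes close
  to all of the finite set \<open>A\<close>. The constant \<open>K\<close> depends on the given
  structure alone.\<close>

lemma local_structure_imp_good:
  fixes X :: "'a::banach set"
  assumes "local_structure \<pi> X"
  shows "\<exists>K\<ge>1. \<forall>A \<delta>. finite A \<and> A \<subseteq> X \<and> 0 < \<delta> \<longrightarrow>
    (\<exists>xs. good \<pi> K X xs \<and> (\<forall>a\<in>A. \<exists>y\<in>span (set xs). norm (a - y) < \<delta>))"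
proof -
  obtain E P K0 where E: "lbs_chain X E"
    and P: "\<pi> \<Longrightarrow> (\<forall>n. linear_proj X (E n) (P n)) \<and> (\<forall>n. \<forall>x\<in>X. norm (P n x) \<le> K0 * norm x)"
    using assms by (cases \<pi>) (auto simp: local_structure_def LBS_def LPBS_def)
  have fd: "\<And>n. fin_dim_subspace (E n)" and inc: "\<And>n. E n \<subseteq> E (Suc n)"
    and X: "X = closure (\<Union>n. E n)" and "bdd_above (range (\<lambda>n. bc (E n)))"
    using E by (auto simp: lbs_chain_def)
  then obtain M where M: "\<And>n. bc (E n) \<le> M" by (auto simp: bdd_above_def)
  \<comment> \<open>\<open>M + 1\<close> leaves room above the infimum \<open>bc (E n)\<close>, so
    that a basis with this bound exists.\<close>
  define K where "K = max 1 (max K0 (M + 1))"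
  have "\<exists>xs. good \<pi> K X xs \<and> (\<forall>a\<in>A. \<exists>y\<in>span (set xs). norm (a - y) < \<delta>)"
    if A: "finite A" "A \<subseteq> X" and \<delta>: "0 < \<delta>" for A \<delta>
  proof -
    have "\<exists>n. \<exists>y\<in>E n. norm (a - y) < \<delta>" if "a \<in> A" for a
    proof -
      have "a \<in> closure (\<Union>n. E n)" using that A X by auto
      then obtain y where "y \<in> (\<Union>n. E n)" "dist y a < \<delta>"
        using \<delta> unfolding closure_approachable by blast
      then show ?thesis by (metis UN_E dist_norm norm_minus_commute)
    qed
    then obtain k where k: "\<And>a. a \<in> A \<Longrightarrow> \<exists>y\<in>E (k a). norm (a - y) < \<delta>" by metis
    \<comment> \<open>The sum is a convenient common upper bound of the finitely many
      indices.\<close>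
    define N where "N = (\<Sum>a\<in>A. k a)"
    have kN: "E (k a) \<subseteq> E N" if "a \<in> A" for a
      using lift_Suc_mono_le[of E "k a" N] inc member_le_sum[of a A k] that A(1)
      by (auto simp: N_def)
    have "bc (E N) < M + 1" using M[of N] by simp
    then obtain xs where xs: "is_basis (E N) xs" "basis_bound (M + 1) xs"
      using basis_bound_of_bc_less[OF fd] by blast
    have sp: "span (set xs) = E N" using xs by (simp add: is_basis_def)
    have "E N \<subseteq> X" unfolding X by (rule order_trans[OF UN_upper closure_subset]) simp
    then have "set xs \<subseteq> X" using sp span_superset by blast
    moreover have "basis_bound K xs" using basis_bound_mono[OF xs(2)] by (simp add: K_def)
    ultimately have "bounded_basis K X xs"
      using xs(1) by (simp add: bounded_basis_def is_basis_def)
    moreover have "bounded_proj K X (span (set xs))" if \<pi>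
    proof -
      have "norm (P N x) \<le> K * norm x" if "x \<in> X" for x
      proof -
        have "norm (P N x) \<le> K0 * norm x" using P \<open>\<pi>\<close> that by blast
        also have "\<dots> \<le> K * norm x" by (intro mult_right_mono) (auto simp: K_def)
        finally show ?thesis .
      qed
      then show ?thesis using P that sp unfolding bounded_proj_def by auto
    qed
    ultimately have "good \<pi> K X xs" by (simp add: good_def)
    moreover have "\<exists>y\<in>span (set xs). norm (a - y) < \<delta>" if "a \<in> A" for a
      unfolding sp using k[OF that] kN[OF that] by (auto dest: subsetD)
    ultimately show ?thesis by blast
  qed
  moreover have "K \<ge> 1" by (simp add: K_def)
  ultimately show ?thesis by blast
qed

text \<open>Each basis is chosen so that its span contains the previous basis and the next vector of
  the dense sequence. The spans then form an increasing chain with dense union, with one constant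
  throughout.\<close>

lemma good_imp_local_structure:
  fixes X :: "'a::banach set" and d :: "nat \<Rightarrow> 'a"
  assumes X: "subspace X" "X = closure (range d)" and K: "1 \<le> K"
    and ex: "\<And>A. finite A \<Longrightarrow> A \<subseteq> X \<Longrightarrow> \<exists>xs. good \<pi> K X xs \<and> A \<subseteq> span (set xs)"
  shows "local_structure \<pi> X"
proof -
  obtain f where f: "\<And>A. finite A \<Longrightarrow> A \<subseteq> X \<Longrightarrow> good \<pi> K X (f A) \<and> A \<subseteq> span (set (f A))"
    using ex by metis
  have dX: "d n \<in> X" for n by (metis X(2) closure_subset rangeI subsetD)
  define s where "s = rec_nat (f {}) (\<lambda>n xs. f (insert (d n) (set xs)))"
  have s0: "s 0 = f {}" and sS: "\<And>n. s (Suc n) = f (insert (d n) (set (s n)))"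
    by (simp_all add: s_def)
  have setX: "good \<pi> K X xs \<Longrightarrow> set xs \<subseteq> X" for xs by (simp add: good_def bounded_basis_def)
  have gs: "good \<pi> K X (s n)" for n
  proof (induction n)
    case 0
    then show ?case using f[of "{}"] s0 by simp
  next
    case (Suc n)
    then show ?case using f[of "insert (d n) (set (s n))"] dX setX by (simp add: sS)
  qed
  have step: "insert (d n) (set (s n)) \<subseteq> span (set (s (Suc n)))" for n
    using f[of "insert (d n) (set (s n))"] dX setX[OF gs[of n]] by (simp add: sS)
  define E where "E n = span (set (s n))" for n
  have basis: "is_basis (E n) (s n)" and bound: "basis_bound K (s n)" for n
    using gs[of n] by (auto simp: E_def is_basis_def good_def bounded_basis_def)
  have EX: "E n \<subseteq> X" for n unfolding E_def using setX[OF gs] X(1) by (intro span_minimal)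
  have "closed X" by (metis X(2) closed_closure)
  have chain: "lbs_chain X E"
    unfolding lbs_chain_def
  proof (intro conjI allI)
    show "fin_dim_subspace (E n)" for n by (auto simp: E_def fin_dim_subspace_def)
    show "E n \<subseteq> E (Suc n)" for n
      using step[of n] unfolding E_def by (intro span_minimal) auto
    have "range d \<subseteq> (\<Union>n. E n)" using step by (auto simp: E_def)
    then have "X \<subseteq> closure (\<Union>n. E n)" by (metis X(2) closure_mono)
    moreover have "closure (\<Union>n. E n) \<subseteq> X" using EX \<open>closed X\<close> by (intro closure_minimal) auto
    ultimately show "X = closure (\<Union>n. E n)" by blast
    show "bdd_above (range (\<lambda>n. bc (E n)))"
      by (rule bdd_aboveI2[where M = K]) (rule bc_le[OF basis K bound])
  qed
  show ?thesis
  proof (cases \<pi>)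
    case True
    have "\<forall>n. \<exists>Q. linear_proj X (E n) Q \<and> (\<forall>x\<in>X. norm (Q x) \<le> K * norm x)"
      using gs True unfolding good_def bounded_proj_def E_def by blast
    then obtain Q where "\<And>n. linear_proj X (E n) (Q n)" "\<And>n x. x \<in> X \<Longrightarrow> norm (Q n x) \<le> K * norm x"
      by metis
    then have "LPBS X" using chain unfolding LPBS_def by blast
    then show ?thesis using True by (simp add: local_structure_def)
  next
    case False
    then show ?thesis using chain unfolding local_structure_def LBS_def by auto
  qed
qed

section \<open>Combinations of rational vectors\<close>

text \<open>Packing the coefficients into a finitely supported sequence lets them range over
  \<open>c00\<close>, where rational sequences are dense for every pseudonorm. \<open>qcomb\<close>
  is the rational counterpart, on which a pseudonorm on \<open>ratseq\<close> can be
  evaluated.\<close>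

definition comb :: "nat \<Rightarrow> c00 \<Rightarrow> (nat \<Rightarrow> 'a::real_vector) \<Rightarrow> 'a"
  where "comb n x p = (\<Sum>i<n. Poly_Mapping.lookup x i *\<^sub>R p i)"

definition qcomb :: "nat \<Rightarrow> ratseq \<Rightarrow> (nat \<Rightarrow> ratseq) \<Rightarrow> ratseq"
  where "qcomb n v p = (\<Sum>i<n. qscale (Poly_Mapping.lookup v i) (p i))"

definition rat_span :: "ratseq list \<Rightarrow> ratseq set"
  where "rat_span w = {v. to_c00 v \<in> span (to_c00 ` set w)}"

definition rat_independent :: "ratseq list \<Rightarrow> bool"
  where "rat_independent w \<longleftrightarrow> distinct (map to_c00 w) \<and> independent (to_c00 ` set w)"

lemma to_c00_sum: "to_c00 (sum f A) = (\<Sum>i\<in>A. to_c00 (f i))"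
  by (induction A rule: infinite_finite_induct) (auto simp: to_c00_zero to_c00_add)

lemma to_c00_qcomb: "to_c00 (qcomb n v p) = comb n (to_c00 v) (\<lambda>i. to_c00 (p i))"
  by (simp add: qcomb_def comb_def to_c00_sum to_c00_qscale lookup_to_c00)

lemma keys_to_c00: "Poly_Mapping.keys (to_c00 v) = Poly_Mapping.keys v"
  by (auto simp: in_keys_iff lookup_to_c00)

lemma linear_comb: "linear (\<lambda>x. comb n x p)"
  by (rule linearI)
    (simp_all add: comb_def lookup_add lookup_scaleR scaleR_left_distrib sum.distrib
      scaleR_sum_right)

lemma linear_comb_right: "linear T \<Longrightarrow> T (comb n x p) = comb n x (\<lambda>i. T (p i))"
  by (simp add: comb_def linear_sum linear_cmul)

lemma comb_cong_keys:
  assumes "Poly_Mapping.keys x \<subseteq> {..<m}" "m \<le> n" "\<And>i. i < m \<Longrightarrow> p i = q i"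
  shows "comb n x p = comb m x q"
  unfolding comb_def
proof (rule sum.mono_neutral_cong_right)
  show "\<forall>i\<in>{..<n} - {..<m}. Poly_Mapping.lookup x i *\<^sub>R p i = 0"
    using assms(1) by (auto simp: in_keys_iff)
qed (use assms in auto)

lemma comb_single:
  assumes "Poly_Mapping.keys x \<subseteq> {..<n}"
  shows "comb n x (\<lambda>i. Poly_Mapping.single i 1) = x"
  by (rule poly_mapping_eqI)
    (use assms in \<open>auto simp: comb_def lookup_sum lookup_scaleR lookup_single when_def in_keys_iff
      if_distrib[of "\<lambda>t. _ * t"] cong: if_cong\<close>)

text \<open>Density of the rational vectors is used for the pseudonorm
  \<open>norm (A x) + norm (B x)\<close>, which makes both maps continuous at once.\<close>

lemma norm_le_of_rational:
  fixes A B :: "c00 \<Rightarrow> 'a::real_normed_vector"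
  assumes lin: "linear A" "linear B" and K: "0 \<le> K"
    and le: "\<And>v. norm (A (to_c00 v)) \<le> K * norm (B (to_c00 v))"
  shows "norm (A x) \<le> K * norm (B x)"
proof (rule field_le_epsilon)
  fix e :: real assume e: "0 < e"
  define \<nu> where "\<nu> x = norm (A x) + norm (B x)" for x
  have "pseudonorm \<nu>"
    unfolding pseudonorm_def
  proof (intro conjI allI)
    show "\<nu> (x + y) \<le> \<nu> x + \<nu> y" for x y
      using norm_triangle_ineq[of "A x" "A y"] norm_triangle_ineq[of "B x" "B y"]
      by (simp add: \<nu>_def linear_add[OF lin(1)] linear_add[OF lin(2)])
  qed (auto simp: \<nu>_def linear_cmul[OF lin(1)] linear_cmul[OF lin(2)] algebra_simps)
  then obtain v where v: "\<nu> (x - to_c00 v) < e / (1 + K)"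
    using to_c00_dense[of \<nu> "e / (1 + K)" x] e K by auto
  let ?a = "norm (A (x - to_c00 v))" and ?b = "norm (B (x - to_c00 v))"
  have "norm (A x) \<le> norm (A (to_c00 v)) + ?a"
    using norm_triangle_sub[of "A x" "A (to_c00 v)"] by (simp add: linear_diff[OF lin(1)])
  also have "\<dots> \<le> K * norm (B (to_c00 v)) + ?a" using le by simp
  also have "\<dots> \<le> K * (norm (B x) + ?b) + ?a"
    using norm_triangle_sub[of "B (to_c00 v)" "B x"] K
    by (auto intro!: mult_left_mono simp: linear_diff[OF lin(2)] norm_minus_commute)
  also have "\<dots> \<le> K * norm (B x) + (1 + K) * (?a + ?b)"
    using K mult_nonneg_nonneg[OF K norm_ge_zero[of "A (x - to_c00 v)"]] by (simp add: algebra_simps)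
  also have "(1 + K) * (?a + ?b) \<le> e"
    using v K by (simp add: \<nu>_def pos_less_divide_eq mult.commute)
  finally show "norm (A x) \<le> K * norm (B x) + e" by simp
qed

definition rat_basis_bound :: "(ratseq \<Rightarrow> real) \<Rightarrow> real \<Rightarrow> ratseq list \<Rightarrow> bool"
  where "rat_basis_bound \<mu> K w \<longleftrightarrow> (\<forall>n m v. n \<le> m \<and> m \<le> length w \<longrightarrow>
    \<mu> (qcomb n v ((!) w)) \<le> K * \<mu> (qcomb m v ((!) w)))"

text \<open>
  Linear independence and the span are taken in \<open>c00\<close>, so they do not involve \<open>\<mu>\<close>; this makes the
  following two conditions closed in \<open>\<mu>\<close>. The two agree with the corresponding notions in \<open>X\<^sub>\<mu>\<close>
  because \<open>\<mu>\<close> is a norm.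
\<close>

definition approx_basis :: "(ratseq \<Rightarrow> real) \<Rightarrow> (nat \<Rightarrow> ratseq) \<Rightarrow> real \<Rightarrow> nat \<Rightarrow>
    ratseq list \<Rightarrow> ratseq list \<Rightarrow> bool"
  where "approx_basis \<mu> e K n w vs \<longleftrightarrow> rat_independent w \<and> rat_basis_bound \<mu> K w \<and>
    length vs = n \<and> set vs \<subseteq> rat_span w \<and> (\<forall>j<n. \<mu> (e j - vs ! j) \<le> 1 / (real n + 1))"

text \<open>\<open>ps\<close> lists the images of the first \<open>N\<close> unit vectors under a
  rational map into the span of \<open>w\<close>. A vector of \<open>w\<close> is tested only when
  its support lies below \<open>N\<close>; so each one is tested for all large \<open>N\<close>,
  with an error tending to 0.\<close>

definition approx_proj :: "(ratseq \<Rightarrow> real) \<Rightarrow> real \<Rightarrow> ratseq list \<Rightarrow> nat \<Rightarrow> ratseq list \<Rightarrow> bool"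
  where "approx_proj \<mu> K w N ps \<longleftrightarrow> length ps = N \<and> set ps \<subseteq> rat_span w \<and>
    (\<forall>v. \<mu> (qcomb N v ((!) ps)) \<le> K * \<mu> (qcomb N v (\<lambda>i. Poly_Mapping.single i 1))) \<and>
    (\<forall>u\<in>set w. Poly_Mapping.keys u \<subseteq> {..<N} \<longrightarrow>
      \<mu> (qcomb N u ((!) ps) - u) \<le> 1 / (real N + 1))"

section \<open>Coordinates, and extension of maps to the closure\<close>

text \<open>Biorthogonal functionals serve as continuous coordinates: the expansion is linear and
  fixes every basis vector, so it fixes the span.\<close>

lemma basis_expansion:
  fixes xs :: "'a::real_normed_vector list"
  assumes "distinct xs" "independent (set xs)"
  shows "\<exists>g. (\<forall>j. bounded_linear (g j)) \<and>
    (\<forall>x\<in>span (set xs). (\<Sum>j<length xs. g j x *\<^sub>R xs ! j) = x)"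
proof -
  obtain g where g: "\<And>b. bounded_linear (g b)"
    "\<And>b c. b \<in> set xs \<Longrightarrow> c \<in> set xs \<Longrightarrow> g b c = (if b = c then 1 else (0::real))"
    using biorthogonal_functionals[OF _ assms(2)] by auto
  define P where "P x = (\<Sum>j<length xs. g (xs ! j) x *\<^sub>R xs ! j)" for x
  have P: "bounded_linear P"
    unfolding P_def by (intro bounded_linear_sum bounded_linear_scaleR_const g)
  have "P c = c" if c: "c \<in> set xs" for c
  proof -
    obtain k where k: "k < length xs" "c = xs ! k" using c by (auto simp: in_set_conv_nth)
    have "P c = (\<Sum>j<length xs. if j = k then c else 0)"
      unfolding P_def by (rule sum.cong) (use g(2) c k assms(1) in \<open>auto simp: nth_eq_iff_index_eq\<close>)
    then show ?thesis using k by simp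
  qed
  then have "P x = x" if "x \<in> span (set xs)" for x
    using linear_eq_on_span[OF bounded_linear.linear[OF P] linear_ident _ that] by simp
  then show ?thesis using g(1) unfolding P_def by (intro exI[of _ "\<lambda>j. g (xs ! j)"]) blast
qed

text \<open>The span is the fixed point set of the coordinate expansion, which is
  continuous.\<close>

lemma closed_span_list:
  fixes xs :: "'a::real_normed_vector list"
  assumes "distinct xs" "independent (set xs)"
  shows "closed (span (set xs))"
proof -
  obtain g where g: "\<And>j. bounded_linear (g j)"
    "\<And>x. x \<in> span (set xs) \<Longrightarrow> (\<Sum>j<length xs. g j x *\<^sub>R xs ! j) = x"
    using basis_expansion[OF assms] by blast
  define P where "P x = (\<Sum>j<length xs. g j x *\<^sub>R xs ! j)" for x
  have P: "bounded_linear P"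
    unfolding P_def by (intro bounded_linear_sum bounded_linear_scaleR_const g)
  have "P x \<in> span (set xs)" for x
    unfolding P_def by (intro span_sum span_scale span_base) auto
  then have "span (set xs) = {x. P x = x}"
    using g(2) unfolding P_def by (auto, metis)
  moreover have "closed {x. P x = x}"
    using P by (intro closed_Collect_eq linear_continuous_on continuous_on_id)
  ultimately show ?thesis by simp
qed

lemma linear_proj_sum:
  assumes Q: "linear_proj X E Q" and X: "subspace X" and A: "\<And>i. i \<in> A \<Longrightarrow> p i \<in> X"
  shows "Q (\<Sum>i\<in>A. c i *\<^sub>R p i) = (\<Sum>i\<in>A. c i *\<^sub>R Q (p i))"
proof -
  have add: "\<And>x y. x \<in> X \<Longrightarrow> y \<in> X \<Longrightarrow> Q (x + y) = Q x + Q y"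
    and mul: "\<And>c x. x \<in> X \<Longrightarrow> Q (c *\<^sub>R x) = c *\<^sub>R Q x"
    using Q by (auto simp: linear_proj_def)
  have "Q 0 = 0" using mul[OF subspace_0[OF X], of 0] by simp
  then show ?thesis
    using A
  proof (induction A rule: infinite_finite_induct)
    case (insert i A)
    have "(\<Sum>i\<in>A. c i *\<^sub>R p i) \<in> X"
      using insert.prems by (intro subspace_sum subspace_scale X) auto
    moreover have "c i *\<^sub>R p i \<in> X" using insert.prems by (intro subspace_scale X) auto
    ultimately show ?case using insert by (simp add: add mul)
  qed auto
qed

text \<open>\<open>L\<close> composed with the inverse of \<open>T\<close> is Lipschitz on
  \<open>range T\<close>, so it extends to the closure. Linearity, the bound and membership in the
  closed set \<open>F\<close> pass to limits of sequences from \<open>range T\<close>. The extension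
  is the identity on \<open>F\<close>, hence idempotent.\<close>

lemma bounded_proj_closure:
  fixes T L :: "'b::real_vector \<Rightarrow> 'a::banach"
  assumes T: "linear T" "inj T" and L: "linear L" and K: "0 \<le> K"
    and le: "\<And>x. norm (L x) \<le> K * norm (T x)"
    and F: "closed F" "\<And>x. L x \<in> F" "F \<subseteq> range T" "\<And>x. T x \<in> F \<Longrightarrow> L x = T x"
  shows "bounded_proj K (closure (range T)) F"
proof -
  define h where "h y = L (inv T y)" for y
  have hT: "h (T x) = L x" for x using T(2) by (simp add: h_def)
  have "uniformly_continuous_on (range T) h"
    unfolding uniformly_continuous_on_def
  proof (intro allI impI)
    fix e :: real assume e: "0 < e"
    \<comment> \<open>\<open>1 + K\<close> in place of \<open>K\<close> allows for
      \<open>K = 0\<close>.\<close>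
    have "dist (h x') (h x) < e" if xx: "x \<in> range T" "x' \<in> range T" "dist x' x < e / (1 + K)" for x x'
    proof -
      obtain a b where ab: "x = T a" "x' = T b" using xx by auto
      have "dist (h x') (h x) \<le> K * dist x' x"
        using le[of "b - a"] by (simp add: ab hT dist_norm linear_diff[OF L] linear_diff[OF T(1)])
      also have "\<dots> \<le> (1 + K) * dist x' x" by (simp add: algebra_simps)
      also have "\<dots> < e" using xx(3) K by (simp add: pos_less_divide_eq mult.commute)
      finally show ?thesis .
    qed
    then show "\<exists>d>0. \<forall>x\<in>range T. \<forall>x'\<in>range T. dist x' x < d \<longrightarrow> dist (h x') (h x) < e"
      using e K by (intro exI[of _ "e / (1 + K)"]) auto
  qed
  then obtain Q where Q: "uniformly_continuous_on (closure (range T)) Q"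
    "\<And>y. y \<in> range T \<Longrightarrow> h y = Q y"
    by (rule uniformly_continuous_on_extension_on_closure) blast
  have QT: "Q (T x) = L x" for x using Q(2)[of "T x"] hT by simp
  have cont: "continuous_on (closure (range T)) Q"
    using Q(1) by (rule uniformly_continuous_imp_continuous)
  have lim: "(\<lambda>n. L (s n)) \<longlonglongrightarrow> Q x" if "(\<lambda>n. T (s n)) \<longlonglongrightarrow> x" for s x
  proof -
    have "x \<in> closure (range T)" using that unfolding closure_sequential by (intro exI[of _ "\<lambda>n. T (s n)"]) auto
    moreover have "T (s n) \<in> closure (range T)" for n
      by (rule subsetD[OF closure_subset]) simp
    ultimately have "(Q \<circ> (\<lambda>n. T (s n))) \<longlonglongrightarrow> Q x"
      using cont[unfolded continuous_on_sequentially, rule_format, of x "\<lambda>n. T (s n)"] that by simp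
    then show ?thesis by (simp add: o_def QT)
  qed
  have seq: "\<exists>s. (\<lambda>n. T (s n)) \<longlonglongrightarrow> x" if x: "x \<in> closure (range T)" for x
  proof -
    obtain t where t: "\<And>n. t n \<in> range T" "t \<longlonglongrightarrow> x"
      using x unfolding closure_sequential by blast
    define s where "s n = inv T (t n)" for n
    have "T (s n) = t n" for n
      unfolding s_def by (rule f_inv_into_f[OF t(1)])
    then have "t = (\<lambda>n. T (s n))" by (simp add: fun_eq_iff)
    then show ?thesis using t(2) by blast
  qed
  have QF: "Q x \<in> F" if x: "x \<in> closure (range T)" for x
  proof -
    obtain s where "(\<lambda>n. T (s n)) \<longlonglongrightarrow> x" using seq[OF x] by blast
    from closed_sequentially[OF F(1) _ lim[OF this]] show ?thesis using F(2) by blast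
  qed
  have Qid: "Q y = y" if y: "y \<in> F" for y
  proof -
    obtain x where x: "y = T x" using F(3) y by auto
    then show ?thesis using F(4)[of x] y QT by simp
  qed
  have "linear_proj (closure (range T)) F Q"
    unfolding linear_proj_def
  proof (intro conjI ballI allI)
    fix x y assume xy: "x \<in> closure (range T)" "y \<in> closure (range T)"
    obtain s where s: "(\<lambda>n. T (s n)) \<longlonglongrightarrow> x" using seq[OF xy(1)] by blast
    obtain t where t: "(\<lambda>n. T (t n)) \<longlonglongrightarrow> y" using seq[OF xy(2)] by blast
    note st = s t
    have "(\<lambda>n. T (s n + t n)) \<longlonglongrightarrow> x + y"
      using tendsto_add[OF st] by (simp add: linear_add[OF T(1)])
    from lim[OF this] have "(\<lambda>n. L (s n) + L (t n)) \<longlonglongrightarrow> Q (x + y)"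
      by (simp add: linear_add[OF L])
    then show "Q (x + y) = Q x + Q y"
      using tendsto_add[OF lim[OF st(1)] lim[OF st(2)]] LIMSEQ_unique by blast
  next
    fix c x assume x: "x \<in> closure (range T)"
    obtain s where s: "(\<lambda>n. T (s n)) \<longlonglongrightarrow> x" using seq[OF x] by blast
    have "(\<lambda>n. T (c *\<^sub>R s n)) \<longlonglongrightarrow> c *\<^sub>R x"
      using tendsto_scaleR[OF tendsto_const s, of c] by (simp add: linear_cmul[OF T(1)])
    from lim[OF this] have "(\<lambda>n. c *\<^sub>R L (s n)) \<longlonglongrightarrow> Q (c *\<^sub>R x)"
      by (simp add: linear_cmul[OF L])
    then show "Q (c *\<^sub>R x) = c *\<^sub>R Q x"
      using tendsto_scaleR[OF tendsto_const lim[OF s], of c] LIMSEQ_unique by blast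
  next
    have "F \<subseteq> closure (range T)" by (rule order_trans[OF F(3) closure_subset])
    then show "Q ` closure (range T) = F" using QF Qid by (auto intro!: image_eqI[where f = Q])
    show "Q (Q x) = Q x" if "x \<in> closure (range T)" for x using Qid QF that by blast
  qed
  moreover have "norm (Q x) \<le> K * norm x" if x: "x \<in> closure (range T)" for x
  proof -
    obtain s where s: "(\<lambda>n. T (s n)) \<longlonglongrightarrow> x" using seq[OF x] by blast
    show ?thesis
      by (rule LIMSEQ_le[OF tendsto_norm[OF lim[OF s]] tendsto_mult[OF tendsto_const tendsto_norm[OF s]]])
        (use le in auto)
  qed
  ultimately show ?thesis unfolding bounded_proj_def by blast
qed

section \<open>Rational bases and projections\<close>

text \<open>Instantiated below with \<open>canon \<mu>\<close> and \<open>Xsp \<mu>\<close>;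
  injectivity of \<open>T\<close> expresses that \<open>\<mu>\<close> is a norm.\<close>

locale dense_realization =
  fixes T :: "c00 \<Rightarrow> 'a::banach" and \<mu> :: "ratseq \<Rightarrow> real" and X :: "'a set"
  assumes T: "linear T" "inj T" and norm_T: "\<And>v. norm (T (to_c00 v)) = \<mu> v"
    and X: "X = closure (range T)"
begin

abbreviation (input) \<tau> :: "ratseq \<Rightarrow> 'a"
  where "\<tau> v \<equiv> T (to_c00 v)"

lemma subspace_X: "subspace X"
  unfolding X
proof (rule subspaceI)
  have sub: "subspace (range T)"
    using linear_subspace_image[OF T(1) subspace_UNIV] by simp
  show "0 \<in> closure (range T)"
    by (rule subsetD[OF closure_subset subspace_0[OF sub]])
  show "x + y \<in> closure (range T)" if xy: "x \<in> closure (range T)" "y \<in> closure (range T)" for x y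
  proof -
    obtain s t where "\<forall>n. s n \<in> range T" "s \<longlonglongrightarrow> x" "\<forall>n. t n \<in> range T" "t \<longlonglongrightarrow> y"
      using xy unfolding closure_sequential by blast
    then show ?thesis
      unfolding closure_sequential
      by (intro exI[of _ "\<lambda>n. s n + t n"] conjI allI tendsto_add subspace_add[OF sub]) auto
  qed
  show "c *\<^sub>R x \<in> closure (range T)" if x: "x \<in> closure (range T)" for c x
  proof -
    obtain s where "\<forall>n. s n \<in> range T" "s \<longlonglongrightarrow> x"
      using x unfolding closure_sequential by blast
    then show ?thesis
      unfolding closure_sequential
      by (intro exI[of _ "\<lambda>n. c *\<^sub>R s n"] conjI allI tendsto_scaleR tendsto_const
          subspace_scale[OF sub]) auto
  qed
qed

lemma range_subset_X: "T x \<in> X"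
  unfolding X by (rule subsetD[OF closure_subset]) simp

lemma rational_dense:
  assumes "x \<in> X" "0 < e"
  shows "\<exists>v. norm (\<tau> v - x) < e"
proof -
  obtain y where "dist (T y) x < e / 2"
    using assms unfolding X closure_approachable by (metis half_gt_zero rangeE)
  moreover have "pseudonorm (\<lambda>x. norm (T x))"
    by (auto simp: pseudonorm_def linear_add[OF T(1)] linear_cmul[OF T(1)] norm_triangle_ineq)
  from to_c00_dense[OF this, of "e / 2" y] obtain v where "norm (T y - \<tau> v) < e / 2"
    using assms(2) by (auto simp: linear_diff[OF T(1)])
  ultimately have "norm (\<tau> v - x) < e"
    using norm_triangle_ineq[of "\<tau> v - T y" "T y - x"] by (simp add: dist_norm norm_minus_commute)
  then show ?thesis by blast
qed

lemma T_qcomb: "\<tau> (qcomb n v p) = comb n (to_c00 v) (\<lambda>i. \<tau> (p i))"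
  by (simp add: to_c00_qcomb linear_comb_right[OF T(1)])

lemma mu_qcomb: "\<mu> (qcomb n v p) = norm (comb n (to_c00 v) (\<lambda>i. \<tau> (p i)))"
  by (simp add: norm_T[symmetric] T_qcomb)

lemma mu_diff: "\<mu> (u - v) = norm (\<tau> u - \<tau> v)"
  by (simp add: norm_T[symmetric] to_c00_diff linear_diff[OF T(1)])

lemma set_map_T: "set (map (\<lambda>v. \<tau> v) w) = T ` to_c00 ` set w"
  by (simp add: image_image)

lemma rat_span_T: "v \<in> rat_span w \<Longrightarrow> \<tau> v \<in> span (set (map (\<lambda>v. \<tau> v) w))"
  unfolding rat_span_def set_map_T by (auto simp: linear_span_image[OF T(1)])

text \<open>Injectivity of \<open>T\<close> gives one direction and its linear left inverse the
  other.\<close>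

lemma rat_independent_iff:
  "rat_independent w \<longleftrightarrow>
    distinct (map (\<lambda>v. \<tau> v) w) \<and> independent (set (map (\<lambda>v. \<tau> v) w))"
proof -
  have "distinct (map (\<lambda>v. \<tau> v) w) \<longleftrightarrow> distinct (map to_c00 w)"
    using T(2) by (auto simp: distinct_map inj_on_def inj_def)
  moreover have "independent (T ` A) \<longleftrightarrow> independent A" for A
  proof
    show "independent (T ` A)" if "independent A"
      using linear_independent_injective_image[OF T(1) that] T(2) by (simp add: inj_on_subset)
    obtain g where g: "linear g" "g \<circ> T = id"
      using linear_injective_left_inverse[OF T] by blast
    have gT: "g (T x) = x" for x using g(2) by (metis comp_apply id_apply)
    have "inj_on g (span (T ` A))"
      unfolding linear_span_image[OF T(1)] by (rule inj_onI) (auto simp: gT)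
    moreover have "g ` T ` A = A" by (simp add: image_image gT)
    ultimately show "independent A" if "independent (T ` A)"
      using linear_independent_injective_image[OF g(1) that] by simp
  qed
  ultimately show ?thesis unfolding rat_independent_def set_map_T by blast
qed

text \<open>Real coefficients, cut off at \<open>m\<close> to form an element of \<open>c00\<close>,
  are reduced to rational ones by \<open>norm_le_of_rational\<close>.\<close>

lemma rat_basis_bound_iff:
  assumes "0 \<le> K"
  shows "rat_basis_bound \<mu> K w \<longleftrightarrow> basis_bound K (map (\<lambda>v. \<tau> v) w)"
proof
  assume "basis_bound K (map (\<lambda>v. \<tau> v) w)"
  then show "rat_basis_bound \<mu> K w"
    unfolding rat_basis_bound_def basis_bound_def mu_qcomb comb_def by simp
next
  assume *: "rat_basis_bound \<mu> K w"
  show "basis_bound K (map (\<lambda>v. \<tau> v) w)"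
    unfolding basis_bound_def
  proof (intro allI impI)
    fix n m and a :: "nat \<Rightarrow> real"
    assume nm: "n \<le> m \<and> m \<le> length (map (\<lambda>v. \<tau> v) w)"
    let ?p = "\<lambda>i. \<tau> (w ! i)"
    define x :: c00 where "x = (\<Sum>i<m. Poly_Mapping.single i (a i))"
    have x: "Poly_Mapping.lookup x i = a i" if "i < m" for i
      using that by (simp add: x_def lookup_sum lookup_single when_def)
    have "norm (comb n x ?p) \<le> K * norm (comb m x ?p)"
      by (rule norm_le_of_rational[OF linear_comb linear_comb assms])
        (use * nm in \<open>auto simp: rat_basis_bound_def mu_qcomb\<close>)
    moreover have "comb k x ?p = (\<Sum>i<k. a i *\<^sub>R map (\<lambda>v. \<tau> v) w ! i)" if "k \<le> m" for k
      unfolding comb_def by (rule sum.cong) (use that nm x in auto)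
    ultimately show "norm (\<Sum>i<n. a i *\<^sub>R map (\<lambda>v. \<tau> v) w ! i)
        \<le> K * norm (\<Sum>i<m. a i *\<^sub>R map (\<lambda>v. \<tau> v) w ! i)"
      using nm by simp
  qed
qed

lemma rat_span_dense:
  assumes "y \<in> span (set (map (\<lambda>v. \<tau> v) w))" "0 < e"
  shows "\<exists>v\<in>rat_span w. norm (y - \<tau> v) < e"
  using assms
proof (induction arbitrary: e rule: span_induct_alt)
  case base
  have "0 \<in> rat_span w" by (simp add: rat_span_def to_c00_zero span_zero)
  then show ?case using base by (intro bexI[of _ 0]) (auto simp: to_c00_zero linear_0[OF T(1)])
next
  case (step c x y)
  obtain a where a: "a \<in> set w" "x = \<tau> a" using step.hyps(1) by auto
  obtain v where v: "v \<in> rat_span w" "norm (y - \<tau> v) < e / 2"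
    using step.IH[of "e / 2"] step.prems by auto
  have "0 < 1 + norm x" by (simp add: add_pos_nonneg)
  then obtain q where q: "\<bar>c - of_rat q\<bar> < e / 2 / (1 + norm x)"
    using rat_approx[of "e / 2 / (1 + norm x)" c] step.prems by auto
  have "\<bar>c - of_rat q\<bar> * norm x \<le> \<bar>c - of_rat q\<bar> * (1 + norm x)" by (intro mult_left_mono) auto
  also have "\<dots> < e / 2" using iffD1[OF pos_less_divide_eq[OF \<open>0 < 1 + norm x\<close>] q] .
  finally have "norm ((c - of_rat q) *\<^sub>R x) < e / 2" by simp
  moreover have "c *\<^sub>R x + y - \<tau> (qscale q a + v) = (c - of_rat q) *\<^sub>R x + (y - \<tau> v)"
    by (simp add: a to_c00_add to_c00_qscale linear_add[OF T(1)] linear_cmul[OF T(1)] algebra_simps)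
  then have "norm (c *\<^sub>R x + y - \<tau> (qscale q a + v))
      \<le> norm ((c - of_rat q) *\<^sub>R x) + norm (y - \<tau> v)"
    by (simp only: norm_triangle_ineq)
  ultimately have "norm (c *\<^sub>R x + y - \<tau> (qscale q a + v)) < e"
    using v(2) by linarith
  moreover have "to_c00 a \<in> span (to_c00 ` set w)" using a(1) by (intro span_base) simp
  then have "qscale q a + v \<in> rat_span w"
    using v(1) unfolding rat_span_def
    by (simp add: to_c00_add to_c00_qscale span_add span_scale)
  ultimately show ?case by blast
qed

text \<open>The basis vectors are moved to nearby rational ones by an \<open>S\<close> close to the
  identity. A vector \<open>y\<close> of \<open>F\<close> moves by at most \<open>e / 2\<close>, and
  \<open>S y\<close> lies in the new span, where rational vectors are dense.\<close>

lemma good_rational: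
  assumes good: "good \<pi> K X xs" and K: "0 \<le> K"
    and F: "finite F" "F \<subseteq> span (set xs)" and e: "0 < e"
  shows "\<exists>w. rat_independent w \<and> good \<pi> (2 * K) X (map (\<lambda>v. \<tau> v) w) \<and>
    (\<forall>y\<in>F. \<exists>v\<in>rat_span w. norm (y - \<tau> v) < e)"
proof -
  define s where "s = (\<Sum>y\<in>F. norm y)"
  have s: "0 \<le> s" unfolding s_def by (intro sum_nonneg) auto
  \<comment> \<open>\<open>1/3\<close> is what \<open>good_near_identity\<close> needs; the other
    term bounds the displacement of each vector of \<open>F\<close> by \<open>e / 2\<close>, since
    \<open>s\<close> dominates their norms.\<close>
  define c where "c = min (1/3) (e / (2 * (1 + s)))"
  have c: "0 < c" using e s by (simp add: c_def)
  have c3: "c \<le> 1/3" unfolding c_def by (rule min.cobounded1)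
  then have c1: "c < 1" by simp
  have cs: "c * norm y \<le> e / 2" if "y \<in> F" for y
  proof -
    have "norm y \<le> 1 + s" using member_le_sum[of y F norm] that F(1) by (auto simp: s_def)
    then have "c * norm y \<le> e / (2 * (1 + s)) * (1 + s)"
      using c s e by (intro mult_mono) (auto simp: c_def)
    also have "\<dots> = e / 2" using s by (simp add: divide_simps add_nonneg_eq_0_iff)
    finally show ?thesis .
  qed
  have xs: "independent (set xs)" "set xs \<subseteq> X" using good by (auto simp: good_def bounded_basis_def)
  obtain \<delta> where \<delta>: "\<delta> > 0" "\<And>u. (\<forall>b\<in>set xs. u b \<in> X \<and> norm (u b - b) \<le> \<delta>) \<Longrightarrow>
    (\<exists>S. near_identity c X S \<and> (\<forall>b\<in>set xs. S b = u b))"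
    using perturbation[OF subspace_X _ xs c c1] by auto
  have "\<forall>b\<in>set xs. \<exists>v. norm (\<tau> v - b) \<le> \<delta>"
    using rational_dense \<delta>(1) xs(2) by (meson less_imp_le subsetD)
  then obtain r where r: "\<And>b. b \<in> set xs \<Longrightarrow> norm (\<tau> (r b) - b) \<le> \<delta>" by metis
  obtain S where S: "near_identity c X S" "\<And>b. b \<in> set xs \<Longrightarrow> S b = \<tau> (r b)"
    using \<delta>(2)[of "\<lambda>b. \<tau> (r b)"] r range_subset_X by blast
  have lin: "linear S" and Sc: "\<And>x. norm (S x - x) \<le> c * norm x"
    using S(1) by (auto simp: near_identity_def)
  have "near_identity (1/3) X S"
  proof -
    have "norm (S x - x) \<le> 1/3 * norm x" for x
      using Sc[of x] mult_right_mono[OF c3 norm_ge_zero[of x]] by linarith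
    then show ?thesis using S(1) by (auto simp: near_identity_def)
  qed
  from good_near_identity[OF this subspace_X K good]
  have g: "good \<pi> (2 * K) X (map S xs)" .
  define w where "w = map r xs"
  have w: "map S xs = map (\<lambda>v. \<tau> v) w" using S(2) by (simp add: w_def)
  have "rat_independent w"
    unfolding rat_independent_iff using g w by (simp add: good_def bounded_basis_def)
  moreover have "\<exists>v\<in>rat_span w. norm (y - \<tau> v) < e" if y: "y \<in> F" for y
  proof -
    have "S y \<in> S ` span (set xs)" using F(2) y by blast
    also have "\<dots> = span (set (map (\<lambda>v. \<tau> v) w))"
      by (simp only: linear_span_image[OF lin, symmetric] w[symmetric] set_map)
    finally obtain v where v: "v \<in> rat_span w" "norm (S y - \<tau> v) < e / 2"
      using rat_span_dense e by (meson half_gt_zero)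
    have "norm (S y - y) \<le> e / 2" using Sc[of y] cs[OF y] by linarith
    then have "norm (y - \<tau> v) < e"
      using v(2) norm_triangle_ineq[of "y - S y" "S y - \<tau> v"] by (simp add: norm_minus_commute)
    then show ?thesis using v(1) by blast
  qed
  ultimately show ?thesis using g w by auto
qed
end

section \<open>From a bounded projection to rational approximate projections\<close>

context dense_realization
begin

text \<open>This is \<open>coefficient_bound\<close> for the images of the unit vectors. It turns
  errors in the images of single unit vectors into an error relative to the norm of the
  combination.\<close>

lemma coordinates_bounded:
  "\<exists>C\<ge>0. \<forall>x. \<forall>i<N. \<bar>Poly_Mapping.lookup x i\<bar> \<le> C * norm (comb N x (\<lambda>i. T (Poly_Mapping.single i 1)))"
proof -
  define es where "es = map (\<lambda>i. Poly_Mapping.single i 1 :: c00) [0..<N]"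
  have inj: "inj (\<lambda>i. Poly_Mapping.single i 1 :: c00)"
    by (rule injI) (metis lookup_single_eq lookup_single_not_eq one_neq_zero)
  have "independent (set es)"
  proof (rule independent_if_scalars_zero)
    fix f :: "c00 \<Rightarrow> real" and x :: c00
    assume sum: "(\<Sum>x\<in>set es. f x *\<^sub>R x) = 0" and "x \<in> set es"
    then obtain i where i: "i < N" "x = Poly_Mapping.single i 1" by (auto simp: es_def)
    have "(\<Sum>x\<in>set es. f x *\<^sub>R x)
        = (\<Sum>j<N. f (Poly_Mapping.single j 1) *\<^sub>R Poly_Mapping.single j 1)"
      unfolding es_def set_map
      by (subst sum.reindex) (use inj in \<open>auto simp: inj_on_def inj_def lessThan_atLeast0\<close>)
    then have "0 = Poly_Mapping.lookup
        (\<Sum>j<N. f (Poly_Mapping.single j 1) *\<^sub>R (Poly_Mapping.single j 1 :: c00)) i"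
      using sum by simp
    also have "\<dots> = (\<Sum>j<N. if j = i then f (Poly_Mapping.single j 1) else 0)"
      unfolding lookup_sum by (rule sum.cong) (auto simp: lookup_scaleR lookup_single when_def)
    also have "\<dots> = f x" using i by simp
    finally show "f x = 0" by simp
  qed simp
  then have ind: "independent (set (map T es))"
    using linear_independent_injective_image[OF T(1)] T(2) by (simp add: inj_on_subset)
  have dist: "distinct (map T es)"
    using inj T(2) by (simp add: es_def distinct_map comp_def inj_def inj_on_def)
  obtain C where C: "C \<ge> 0" "\<forall>a m i. i < m \<and> m \<le> length (map T es) \<longrightarrow>
    \<bar>a i\<bar> \<le> C * norm (\<Sum>j<m. a j *\<^sub>R map T es ! j)"
    using coefficient_bound[OF dist ind] by (elim exE conjE)
  have "\<bar>Poly_Mapping.lookup x i\<bar> \<le> C * norm (comb N x (\<lambda>i. T (Poly_Mapping.single i 1)))"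
    if i: "i < N" for x i
  proof -
    have "comb N x (\<lambda>i. T (Poly_Mapping.single i 1))
        = (\<Sum>j<N. Poly_Mapping.lookup x j *\<^sub>R map T es ! j)"
      unfolding comb_def by (rule sum.cong) (auto simp: es_def)
    then show ?thesis
      using C(2)[rule_format, of i N "Poly_Mapping.lookup x"] i by (simp add: es_def)
  qed
  then show ?thesis using C(1) by blast
qed

text \<open>The images of the unit vectors under the projection \<open>Q\<close> are replaced by
  rational vectors \<open>p i\<close> of the span. The resulting map differs from \<open>Q\<close>
  by at most \<open>c\<close> times the norm, which \<open>K + 1\<close> absorbs.\<close>

lemma approx_proj_exists:
  assumes proj: "bounded_proj K X (span (set (map (\<lambda>v. \<tau> v) w)))" and K: "0 \<le> K"
  shows "\<exists>ps. approx_proj \<mu> (K + 1) w N ps"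
proof -
  let ?F = "span (set (map (\<lambda>v. \<tau> v) w))"
  let ?u = "\<lambda>i. T (Poly_Mapping.single i 1)"
  obtain Q where Q: "linear_proj X ?F Q" "\<And>x. x \<in> X \<Longrightarrow> norm (Q x) \<le> K * norm x"
    using proj by (auto simp: bounded_proj_def)
  have TX: "T x \<in> X" for x by (rule range_subset_X)
  obtain C where C: "C \<ge> 0"
    "\<And>x i. i < N \<Longrightarrow> \<bar>Poly_Mapping.lookup x i\<bar> \<le> C * norm (comb N x ?u)"
    using coordinates_bounded by blast
  define s where "s = (\<Sum>u\<in>set w. norm (\<tau> u))"
  have s: "0 \<le> s" unfolding s_def by (intro sum_nonneg) auto
  \<comment> \<open>\<open>c <= 1\<close> is for the bound \<open>K + 1\<close>; the other term
    makes the error on each vector of \<open>w\<close> at most \<open>1 / (N + 1)\<close>.\<close>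
  define c where "c = min 1 (1 / ((real N + 1) * (1 + s)))"
  have "0 < (real N + 1) * (1 + s)" using s by (intro mult_pos_pos) auto
  then have c: "0 < c" "c \<le> 1" "c \<le> 1 / ((real N + 1) * (1 + s))" by (auto simp: c_def)
  \<comment> \<open>There are \<open>N\<close> coordinates, each at most \<open>C\<close> times the
    norm; the added 1 keeps the denominator positive when \<open>N\<close> or \<open>C\<close> is
    0.\<close>
  define \<eta> where "\<eta> = c / (real N * C + 1)"
  have "0 < real N * C + 1" using C(1) by (simp add: add_nonneg_pos)
  then have \<eta>: "0 < \<eta>" "real N * C * \<eta> \<le> c" using c(1) C(1) by (auto simp: \<eta>_def field_simps)
  have "\<exists>p\<in>rat_span w. norm (Q (?u i) - \<tau> p) < \<eta>" for i
  proof -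
    have "Q (?u i) \<in> ?F" using Q(1) TX unfolding linear_proj_def by blast
    then show ?thesis by (rule rat_span_dense[OF _ \<eta>(1)])
  qed
  then obtain p where p: "\<And>i. p i \<in> rat_span w" "\<And>i. norm (Q (?u i) - \<tau> (p i)) < \<eta>" by metis
  define ps where "ps = map p [0..<N]"
  have ps: "qcomb N v ((!) ps) = qcomb N v p" for v
    unfolding qcomb_def by (rule sum.cong) (auto simp: ps_def)
  have QT: "Q (comb N x ?u) = comb N x (\<lambda>i. Q (?u i))" for x
    unfolding comb_def by (rule linear_proj_sum[OF Q(1) subspace_X]) (rule TX)
  have cX: "comb N x ?u \<in> X" for x
    using TX[of "comb N x (\<lambda>i. Poly_Mapping.single i 1)"] by (simp add: linear_comb_right[OF T(1)])
  have near: "norm (comb N x (\<lambda>i. \<tau> (p i)) - Q (comb N x ?u)) \<le> c * norm (comb N x ?u)" for x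
  proof -
    have "comb N x (\<lambda>i. \<tau> (p i)) - Q (comb N x ?u)
        = (\<Sum>i<N. Poly_Mapping.lookup x i *\<^sub>R (\<tau> (p i) - Q (?u i)))"
      unfolding QT by (simp add: comb_def sum_subtractf scaleR_diff_right)
    also have "norm \<dots> \<le> (\<Sum>i<N. (C * norm (comb N x ?u)) * \<eta>)"
    proof (rule sum_norm_le)
      fix i assume "i \<in> {..<N}"
      then show "norm (Poly_Mapping.lookup x i *\<^sub>R (\<tau> (p i) - Q (?u i))) \<le> (C * norm (comb N x ?u)) * \<eta>"
        using C(2)[of i x] p(2)[of i] C(1) by (auto simp: norm_minus_commute intro!: mult_mono)
    qed
    also have "\<dots> = (real N * C * \<eta>) * norm (comb N x ?u)" by (simp add: mult_ac)
    also have "\<dots> \<le> c * norm (comb N x ?u)" by (intro mult_right_mono \<eta>(2)) auto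
    finally show ?thesis .
  qed
  have "\<mu> (qcomb N v ((!) ps)) \<le> (K + 1) * \<mu> (qcomb N v (\<lambda>i. Poly_Mapping.single i 1))" for v
  proof -
    let ?x = "comb N (to_c00 v) ?u"
    have "norm (comb N (to_c00 v) (\<lambda>i. \<tau> (p i)))
        \<le> norm (Q ?x) + norm (comb N (to_c00 v) (\<lambda>i. \<tau> (p i)) - Q ?x)"
      by (rule norm_triangle_sub)
    also have "\<dots> \<le> K * norm ?x + c * norm ?x" using Q(2)[OF cX] near by (intro add_mono)
    also have "\<dots> \<le> (K + 1) * norm ?x" using mult_right_mono[OF c(2) norm_ge_zero[of ?x]]
      by (simp add: algebra_simps)
    finally show ?thesis by (simp add: ps mu_qcomb to_c00_single)
  qed
  moreover have "\<mu> (qcomb N u ((!) ps) - u) \<le> 1 / (real N + 1)"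
    if u: "u \<in> set w" "Poly_Mapping.keys u \<subseteq> {..<N}" for u
  proof -
    have x: "comb N (to_c00 u) ?u = \<tau> u"
      using comb_single[of "to_c00 u" N] u(2)
      by (simp add: linear_comb_right[OF T(1), symmetric] keys_to_c00)
    have "\<tau> u \<in> ?F" using u(1) by (intro span_base) auto
    then obtain z where "z \<in> X" "\<tau> u = Q z" using Q(1) unfolding linear_proj_def by blast
    then have "Q (\<tau> u) = \<tau> u" using Q(1) unfolding linear_proj_def by simp
    then have "norm (comb N (to_c00 u) (\<lambda>i. \<tau> (p i)) - \<tau> u) \<le> c * norm (\<tau> u)"
      using near[of "to_c00 u"] by (simp add: x)
    also have "\<dots> \<le> 1 / ((real N + 1) * (1 + s)) * (1 + s)"
    proof (rule mult_mono)
      show "norm (\<tau> u) \<le> 1 + s"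
        using member_le_sum[of u "set w" "\<lambda>u. norm (\<tau> u)"] u(1) by (simp add: s_def)
    qed (use c s in auto)
    also have "\<dots> = 1 / (real N + 1)" using s by simp
    finally show ?thesis by (simp add: ps mu_diff T_qcomb)
  qed
  ultimately have "approx_proj \<mu> (K + 1) w N ps"
    using p(1) by (auto simp: approx_proj_def ps_def)
  then show ?thesis by blast
qed
end

section \<open>Compactness: from approximate projections to a projection\<close>

text \<open>The product of the intervals is compact by Tychonoff; a countable index type makes the
  function space first countable, so compactness yields convergent subsequences.\<close>

lemma pointwise_convergent_subsequence:
  fixes f :: "nat \<Rightarrow> 'i::countable \<Rightarrow> real"
  assumes "\<And>n i. \<bar>f n i\<bar> \<le> C i"
  shows "\<exists>l r. strict_mono (r :: nat \<Rightarrow> nat) \<and> (\<forall>i. (\<lambda>k. f (r k) i) \<longlonglongrightarrow> l i)"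
proof -
  define S where "S = PiE UNIV (\<lambda>i. {- C i..C i})"
  have "compactin (product_topology (\<lambda>i::'i. euclidean) UNIV) S"
    unfolding S_def compactin_PiE by auto
  then have "seq_compact S"
    by (simp add: euclidean_product_topology compact_imp_seq_compact)
  moreover have "\<forall>n. f n \<in> S" using assms by (auto simp: S_def abs_le_iff minus_le_iff)
  ultimately obtain l r where lr: "strict_mono (r :: nat \<Rightarrow> nat)" "(f \<circ> r) \<longlonglongrightarrow> l"
    unfolding seq_compact_def by blast
  have "(\<lambda>k. f (r k) i) \<longlonglongrightarrow> l i" for i
    using continuous_on_tendsto_compose[OF continuous_on_product_coordinates[of i] lr(2)] by simp
  then show ?thesis using lr(1) by blast
qed

lemma keys_bounded:
  fixes x :: "nat \<Rightarrow>\<^sub>0 'b::zero"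
  shows "\<exists>M. Poly_Mapping.keys x \<subseteq> {..<M}"
  using finite_nat_bounded[OF finite_keys[of x]] by blast

context dense_realization
begin

text \<open>For each \<open>i\<close> the images \<open>q N i\<close> stay bounded in a
  finite-dimensional space, so along one subsequence they converge for all \<open>i\<close> at once.
  The limit map \<open>L\<close> keeps the bound \<open>K\<close>, is exact on \<open>w\<close>, and
  extends to \<open>X\<close>.\<close>

lemma bounded_proj_of_approx:
  assumes w: "rat_independent w" and K: "0 \<le> K"
    and ex: "\<And>N. \<exists>ps. approx_proj \<mu> K w N ps"
  shows "bounded_proj K X (span (set (map (\<lambda>v. \<tau> v) w)))"
proof -
  obtain ps where ps: "\<And>N. approx_proj \<mu> K w N (ps N)" using ex by metis
  define bs where "bs = map (\<lambda>v. \<tau> v) w"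
  let ?F = "span (set bs)"
  have bs: "distinct bs" "independent (set bs)"
    using w unfolding bs_def by (auto simp only: rat_independent_iff)
  obtain g where g: "\<And>j. bounded_linear (g j)"
    "\<And>x. x \<in> ?F \<Longrightarrow> (\<Sum>j<length bs. g j x *\<^sub>R bs ! j) = x"
    using basis_expansion[OF bs] by blast
  \<comment> \<open>The value 0 for \<open>i >= N\<close> is a filler: each fixed \<open>i\<close>
    lies below \<open>N\<close> eventually.\<close>
  define q where "q N i = (if i < N then \<tau> (ps N ! i) else 0)" for N i
  have qF: "q N i \<in> ?F" for N i
  proof (cases "i < N")
    case True
    have "length (ps N) = N" "set (ps N) \<subseteq> rat_span w" using ps[of N] by (auto simp: approx_proj_def)
    then have "ps N ! i \<in> rat_span w" using nth_mem[of i "ps N"] True by (auto dest: subsetD)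
    then show ?thesis using True rat_span_T unfolding q_def bs_def by simp
  qed (simp add: q_def span_zero)
  have q_le: "norm (comb M (to_c00 v) (q N)) \<le> K * norm (\<tau> v)"
    if "Poly_Mapping.keys v \<subseteq> {..<M}" "M \<le> N" for v M N
  proof -
    have kv: "Poly_Mapping.keys (to_c00 v) \<subseteq> {..<M}" using that by (simp add: keys_to_c00)
    have "comb M (to_c00 v) (q N) = comb N (to_c00 v) (\<lambda>i. \<tau> (ps N ! i))"
      by (rule comb_cong_keys[OF kv that(2), symmetric]) (use that in \<open>simp add: q_def\<close>)
    moreover have "comb N (to_c00 v) (\<lambda>i. \<tau> (Poly_Mapping.single i 1)) = \<tau> v"
      using comb_single[of "to_c00 v" N] kv that(2)
      by (simp add: linear_comb_right[OF T(1), symmetric] to_c00_single lessThan_subset_iff subset_trans)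
    moreover have "\<mu> (qcomb N v ((!) (ps N))) \<le> K * \<mu> (qcomb N v (\<lambda>i. Poly_Mapping.single i 1))"
      using ps[of N] by (simp add: approx_proj_def)
    ultimately show ?thesis by (simp add: mu_qcomb)
  qed
  have q_close: "norm (comb M (to_c00 u) (q N) - \<tau> u) \<le> 1 / (real N + 1)"
    if "u \<in> set w" "Poly_Mapping.keys u \<subseteq> {..<M}" "M \<le> N" for u M N
  proof -
    have "comb M (to_c00 u) (q N) = comb N (to_c00 u) (\<lambda>i. \<tau> (ps N ! i))"
      by (rule comb_cong_keys[symmetric]) (use that in \<open>simp_all add: q_def keys_to_c00\<close>)
    moreover have "Poly_Mapping.keys u \<subseteq> {..<N}" using that(2,3) by auto
    then have "\<mu> (qcomb N u ((!) (ps N)) - u) \<le> 1 / (real N + 1)"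
      using ps[of N] that(1) by (simp add: approx_proj_def)
    ultimately show ?thesis by (simp add: mu_diff T_qcomb)
  qed
  have q_norm: "norm (q N i) \<le> K * norm (T (Poly_Mapping.single i 1))" for N i
  proof (cases "i < N")
    case True
    have "comb (Suc i) (to_c00 (Poly_Mapping.single i 1)) (q N) = q N i"
      by (simp add: comb_def to_c00_single lookup_single when_def)
    then show ?thesis
      using q_le[of "Poly_Mapping.single i 1" "Suc i" N] True by (simp add: to_c00_single)
  qed (use K in \<open>simp add: q_def\<close>)
  \<comment> \<open>Coordinates of all images, indexed by pairs, so that a single extraction
    replaces a diagonal argument.\<close>
  define f where "f N = (\<lambda>(i, j). g j (q N i))" for N
  have "\<bar>f N ij\<bar> \<le> (case ij of (i, j) \<Rightarrow> onorm (g j) * (K * norm (T (Poly_Mapping.single i 1))))" for N ij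
  proof (cases ij)
    case (Pair i j)
    have "\<bar>g j (q N i)\<bar> \<le> onorm (g j) * norm (q N i)" using onorm[OF g(1), of j "q N i"] by simp
    also have "\<dots> \<le> onorm (g j) * (K * norm (T (Poly_Mapping.single i 1)))"
      by (intro mult_left_mono q_norm onorm_pos_le g)
    finally show ?thesis by (simp add: Pair f_def)
  qed
  from pointwise_convergent_subsequence[of f, OF this]
  obtain l r where r: "strict_mono (r :: nat \<Rightarrow> nat)"
    and l: "\<And>ij. (\<lambda>k. f (r k) ij) \<longlonglongrightarrow> l ij" by blast
  define p where "p i = (\<Sum>j<length bs. l (i, j) *\<^sub>R bs ! j)" for i
  have pF: "p i \<in> ?F" for i
    unfolding p_def by (intro span_sum span_scale span_base) auto
  have "(\<lambda>k. \<Sum>j<length bs. g j (q (r k) i) *\<^sub>R bs ! j) \<longlonglongrightarrow> p i" for i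
    unfolding p_def using l[of "(i, _)"] by (intro tendsto_sum tendsto_scaleR tendsto_const) (simp add: f_def)
  then have qp: "(\<lambda>k. q (r k) i) \<longlonglongrightarrow> p i" for i by (simp only: g(2)[OF qF])
  have comb_lim: "(\<lambda>k. comb M x (q (r k))) \<longlonglongrightarrow> comb M x p" for M x
    unfolding comb_def by (intro tendsto_sum tendsto_scaleR tendsto_const qp)
  have rM: "M \<le> r k" if "M \<le> k" for M k using seq_suble[OF r, of k] that by simp
  \<comment> \<open>Summing over the support makes \<open>L\<close> independent of a length; it
    equals \<open>comb M x p\<close> for every \<open>M\<close> beyond the support.\<close>
  define L where "L x = (\<Sum>i\<in>Poly_Mapping.keys x. Poly_Mapping.lookup x i *\<^sub>R p i)" for x
  have L: "L x = comb M x p" if "Poly_Mapping.keys x \<subseteq> {..<M}" for x M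
    unfolding L_def comb_def by (rule sum.mono_neutral_left) (use that in \<open>auto simp: in_keys_iff\<close>)
  have linL: "linear L"
  proof (rule linearI)
    fix x y :: c00
    obtain M where M: "Poly_Mapping.keys x \<union> Poly_Mapping.keys y \<subseteq> {..<M}"
      using finite_nat_bounded[of "Poly_Mapping.keys x \<union> Poly_Mapping.keys y"] by auto
    then have "Poly_Mapping.keys (x + y) \<subseteq> {..<M}" using keys_add[of x y] by blast
    with M show "L (x + y) = L x + L y"
      using L[of x M] L[of y M] L[of "x + y" M] linear_add[OF linear_comb[of M p], of x y] by simp
  next
    fix c and x :: c00
    obtain M where M: "Poly_Mapping.keys x \<subseteq> {..<M}" using keys_bounded by blast
    moreover have "Poly_Mapping.keys (c *\<^sub>R x) \<subseteq> Poly_Mapping.keys x"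
      by (auto simp: in_keys_iff lookup_scaleR)
    ultimately show "L (c *\<^sub>R x) = c *\<^sub>R L x"
      using L[OF M] L[of "c *\<^sub>R x" M] linear_cmul[OF linear_comb[of M p]] by (simp add: subset_trans)
  qed
  have "norm (L (to_c00 v)) \<le> K * norm (\<tau> v)" for v
  proof -
    obtain M where M: "Poly_Mapping.keys v \<subseteq> {..<M}" using keys_bounded by blast
    then have "norm (comb M (to_c00 v) p) \<le> K * norm (\<tau> v)"
      by (intro LIMSEQ_le_const2[OF tendsto_norm[OF comb_lim]] exI[of _ M]) (simp add: q_le rM)
    then show ?thesis using L[of "to_c00 v" M] M by (simp add: keys_to_c00)
  qed
  then have leL: "norm (L x) \<le> K * norm (T x)" for x
    by (rule norm_le_of_rational[OF linL T(1) K])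
  have Lw: "L (to_c00 u) = \<tau> u" if u: "u \<in> set w" for u
  proof -
    obtain M where M: "Poly_Mapping.keys u \<subseteq> {..<M}" using keys_bounded by blast
    \<comment> \<open>In the limit the error \<open>1 / (N + 1)\<close> disappears.\<close>
    have "norm (comb M (to_c00 u) p - \<tau> u) \<le> 0"
    proof (rule LIMSEQ_le[OF tendsto_norm[OF tendsto_diff[OF comb_lim tendsto_const]]
          LIMSEQ_inverse_real_of_nat], intro exI[of _ M] allI impI)
      fix k assume k: "M \<le> k"
      have "norm (comb M (to_c00 u) (q (r k)) - \<tau> u) \<le> 1 / (real (r k) + 1)"
        by (rule q_close[OF u M rM[OF k]])
      also have "\<dots> \<le> inverse (real (Suc k))"
        using seq_suble[OF r, of k] by (simp add: inverse_eq_divide frac_le)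
      finally show "norm (comb M (to_c00 u) (q (r k)) - \<tau> u) \<le> inverse (real (Suc k))" .
    qed
    then show ?thesis using L[of "to_c00 u" M] M by (simp add: keys_to_c00)
  qed
  have F_eq: "?F = T ` span (to_c00 ` set w)"
    unfolding bs_def set_map_T by (simp add: linear_span_image[OF T(1)])
  have "bounded_proj K (closure (range T)) ?F"
  proof (rule bounded_proj_closure[OF T linL K leL closed_span_list[OF bs]])
    show "L x \<in> ?F" for x unfolding L_def by (intro span_sum span_scale pF)
    show "?F \<subseteq> range T" unfolding F_eq by blast
    show "L x = T x" if "T x \<in> ?F" for x
    proof -
      have "x \<in> span (to_c00 ` set w)" using that T(2) unfolding F_eq by (auto dest: injD)
      then show ?thesis by (rule linear_eq_on_span[OF linL T(1), rotated]) (use Lw in auto)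
    qed
  qed
  then show ?thesis by (simp add: X bs_def)
qed

section \<open>The local structures in terms of rational data\<close>

lemma mu_nonneg: "0 \<le> \<mu> v"
  by (simp add: norm_T[symmetric])

lemma approx_proj_mono: "approx_proj \<mu> K w N ps \<Longrightarrow> K \<le> L \<Longrightarrow> approx_proj \<mu> L w N ps"
  unfolding approx_proj_def by (meson mult_right_mono mu_nonneg order_trans)

lemma closure_range_rational:
  assumes "surj e"
  shows "X = closure (range (\<lambda>j. \<tau> (e j)))"
proof
  show "X \<subseteq> closure (range (\<lambda>j. \<tau> (e j)))"
  proof
    fix x assume x: "x \<in> X"
    show "x \<in> closure (range (\<lambda>j. \<tau> (e j)))"
      unfolding closure_approachable
    proof (intro allI impI)
      fix d :: real assume "0 < d"
      then obtain v where "norm (\<tau> v - x) < d" using rational_dense[OF x] by blast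
      moreover obtain j where "e j = v" using assms by (metis surjD)
      ultimately show "\<exists>y\<in>range (\<lambda>j. \<tau> (e j)). dist y x < d" by (auto simp: dist_norm)
    qed
  qed
  show "closure (range (\<lambda>j. \<tau> (e j))) \<subseteq> X"
    unfolding X by (rule closure_mono) auto
qed

text \<open>Forward, a good basis is made rational, with the error split between reaching its span
  and reaching a rational vector. Backward, the data for large \<open>n\<close> give good bases
  whose spans approximate any finite set; \<open>good_absorb_finite\<close> then makes the inclusion
  exact.\<close>

lemma local_structure_iff:
  assumes e: "surj e"
  shows "local_structure \<pi> X \<longleftrightarrow> (\<exists>K::nat. \<forall>n. \<exists>w vs. approx_basis \<mu> e K n w vs \<and>
    (\<pi> \<longrightarrow> (\<forall>N. \<exists>ps. approx_proj \<mu> K w N ps)))"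
proof
  assume "local_structure \<pi> X"
  from local_structure_imp_good[OF this] obtain K0 where K0: "1 \<le> K0"
    "\<And>A \<delta>. finite A \<Longrightarrow> A \<subseteq> X \<Longrightarrow> 0 < \<delta> \<Longrightarrow>
      \<exists>xs. good \<pi> K0 X xs \<and> (\<forall>a\<in>A. \<exists>y\<in>span (set xs). norm (a - y) < \<delta>)" by metis
  \<comment> \<open>The factor 2 is lost in \<open>good_rational\<close>, the summand 1 in
    \<open>approx_proj_exists\<close>.\<close>
  obtain K :: nat where K: "2 * K0 + 1 \<le> real K" using real_arch_simple by blast
  have "\<exists>w vs. approx_basis \<mu> e K n w vs \<and> (\<pi> \<longrightarrow> (\<forall>N. \<exists>ps. approx_proj \<mu> K w N ps))" for n
  proof -
    define \<delta> where "\<delta> = 1 / (2 * (real n + 1))"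
    have \<delta>: "0 < \<delta>" "\<delta> + \<delta> = 1 / (real n + 1)" by (auto simp: \<delta>_def field_simps)
    obtain xs where xs: "good \<pi> K0 X xs"
      "\<forall>a\<in>(\<lambda>j. \<tau> (e j)) ` {..<n}. \<exists>y\<in>span (set xs). norm (a - y) < \<delta>"
      using K0(2)[of "(\<lambda>j. \<tau> (e j)) ` {..<n}" \<delta>] \<delta>(1) range_subset_X by auto
    have "\<forall>j\<in>{..<n}. \<exists>y. y \<in> span (set xs) \<and> norm (\<tau> (e j) - y) < \<delta>" using xs(2) by auto
    from bchoice[OF this] obtain y where y: "\<And>j. j < n \<Longrightarrow> y j \<in> span (set xs)"
      "\<And>j. j < n \<Longrightarrow> norm (\<tau> (e j) - y j) < \<delta>" by auto
    obtain w where w: "rat_independent w" "good \<pi> (2 * K0) X (map (\<lambda>v. \<tau> v) w)"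
      "\<forall>z\<in>y ` {..<n}. \<exists>v\<in>rat_span w. norm (z - \<tau> v) < \<delta>"
      using good_rational[OF xs(1) _ _ _ \<delta>(1), of "y ` {..<n}"] K0(1) y(1) by auto
    have "\<forall>j\<in>{..<n}. \<exists>v. v \<in> rat_span w \<and> norm (y j - \<tau> v) < \<delta>" using w(3) by auto
    from bchoice[OF this] obtain v where v: "\<And>j. j < n \<Longrightarrow> v j \<in> rat_span w"
      "\<And>j. j < n \<Longrightarrow> norm (y j - \<tau> (v j)) < \<delta>" by auto
    define vs where "vs = map v [0..<n]"
    have "\<mu> (e j - vs ! j) \<le> 1 / (real n + 1)" if j: "j < n" for j
    proof -
      have "norm (\<tau> (e j) - \<tau> (v j)) \<le> norm (\<tau> (e j) - y j) + norm (y j - \<tau> (v j))"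
        using norm_triangle_ineq[of "\<tau> (e j) - y j" "y j - \<tau> (v j)"] by simp
      then show ?thesis using y(2)[OF j] v(2)[OF j] j \<delta>(2) by (simp add: mu_diff vs_def)
    qed
    moreover have "rat_basis_bound \<mu> K w"
    proof -
      have "basis_bound (2 * K0) (map (\<lambda>v. \<tau> v) w)"
        using w(2) by (simp add: good_def bounded_basis_def)
      then have "basis_bound K (map (\<lambda>v. \<tau> v) w)" by (rule basis_bound_mono) (use K in simp)
      then show ?thesis by (simp only: rat_basis_bound_iff[OF of_nat_0_le_iff])
    qed
    ultimately have "approx_basis \<mu> e K n w vs"
      using w(1) v(1) by (auto simp: approx_basis_def vs_def)
    moreover have "\<exists>ps. approx_proj \<mu> K w N ps" if \<pi> for N
    proof -
      have "bounded_proj (2 * K0) X (span (set (map (\<lambda>v. \<tau> v) w)))"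
        using w(2) that unfolding good_def by blast
      from approx_proj_exists[OF this] K0(1) obtain ps where "approx_proj \<mu> (2 * K0 + 1) w N ps"
        by auto
      then show ?thesis using approx_proj_mono[OF _ K] by blast
    qed
    ultimately show ?thesis by blast
  qed
  then show "\<exists>K::nat. \<forall>n. \<exists>w vs. approx_basis \<mu> e K n w vs \<and>
    (\<pi> \<longrightarrow> (\<forall>N. \<exists>ps. approx_proj \<mu> K w N ps))" by blast
next
  assume "\<exists>K::nat. \<forall>n. \<exists>w vs. approx_basis \<mu> e K n w vs \<and>
    (\<pi> \<longrightarrow> (\<forall>N. \<exists>ps. approx_proj \<mu> K w N ps))"
  then obtain K :: nat where K: "\<And>n. \<exists>w vs. approx_basis \<mu> e K n w vs \<and>
    (\<pi> \<longrightarrow> (\<forall>N. \<exists>ps. approx_proj \<mu> K w N ps))" by blast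
  have appr: "\<exists>xs. good \<pi> K X xs \<and> (\<forall>a\<in>A. \<exists>y\<in>span (set xs). norm (a - y) \<le> \<delta>)"
    if A: "finite A" "A \<subseteq> X" and \<delta>: "0 < \<delta>" for A and \<delta> :: real
  proof -
    have "\<forall>a\<in>A. \<exists>j. norm (\<tau> (e j) - a) < \<delta> / 2"
    proof
      fix a assume "a \<in> A"
      then obtain v where "norm (\<tau> v - a) < \<delta> / 2" using rational_dense[of a "\<delta> / 2"] A(2) \<delta> by auto
      moreover obtain j where "e j = v" using e by (metis surjD)
      ultimately show "\<exists>j. norm (\<tau> (e j) - a) < \<delta> / 2" by auto
    qed
    from bchoice[OF this] obtain k where k: "\<And>a. a \<in> A \<Longrightarrow> norm (\<tau> (e (k a)) - a) < \<delta> / 2" by blast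
    obtain m where m: "inverse (real (Suc m)) < \<delta> / 2" using reals_Archimedean[of "\<delta> / 2"] \<delta> by auto
    \<comment> \<open>Large enough to exceed every index \<open>k a\<close> and to make
      \<open>1 / (n + 1)\<close> less than \<open>\<delta> / 2\<close>.\<close>
    define n where "n = Suc (m + (\<Sum>a\<in>A. k a))"
    have n: "k a < n" if "a \<in> A" for a
      using member_le_sum[of a A k] that A(1) by (simp add: n_def)
    have "real (Suc m) \<le> real n + 1" by (simp add: n_def sum_nonneg)
    then have "1 / (real n + 1) \<le> inverse (real (Suc m))"
      unfolding inverse_eq_divide by (intro frac_le) auto
    then have n': "1 / (real n + 1) < \<delta> / 2" using m by simp
    obtain w vs where w: "approx_basis \<mu> e K n w vs"
      "\<pi> \<Longrightarrow> \<forall>N. \<exists>ps. approx_proj \<mu> K w N ps" using K by blast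
    let ?xs = "map (\<lambda>v. \<tau> v) w"
    have ind: "rat_independent w" and "rat_basis_bound \<mu> K w"
      using w(1) by (auto simp: approx_basis_def)
    then have "distinct ?xs" "independent (set ?xs)" "basis_bound K ?xs"
      using rat_independent_iff rat_basis_bound_iff[OF of_nat_0_le_iff] by blast+
    moreover have "set ?xs \<subseteq> X" using range_subset_X by auto
    moreover have "bounded_proj K X (span (set ?xs))" if \<pi>
      using bounded_proj_of_approx[OF ind of_nat_0_le_iff] w(2)[OF that] by blast
    ultimately have "good \<pi> K X ?xs" by (simp only: good_def bounded_basis_def) blast
    moreover have "\<exists>y\<in>span (set ?xs). norm (a - y) \<le> \<delta>" if a: "a \<in> A" for a
    proof -
      let ?v = "vs ! k a"
      have v: "?v \<in> rat_span w" "\<mu> (e (k a) - ?v) \<le> 1 / (real n + 1)"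
        using w(1) n[OF a] by (auto simp: approx_basis_def)
      have "norm (a - \<tau> ?v) \<le> norm (a - \<tau> (e (k a))) + norm (\<tau> (e (k a)) - \<tau> ?v)"
        using norm_triangle_ineq[of "a - \<tau> (e (k a))" "\<tau> (e (k a)) - \<tau> ?v"] by simp
      also have "\<dots> \<le> \<delta>"
        using k[OF a] v(2) n' by (simp add: mu_diff norm_minus_commute)
      finally show ?thesis using rat_span_T[OF v(1)] by blast
    qed
    ultimately show ?thesis by blast
  qed
  show "local_structure \<pi> X"
  proof (rule good_imp_local_structure[OF subspace_X closure_range_rational[OF e]])
    \<comment> \<open>The added 1 covers the case \<open>K = 0\<close>.\<close>
    show "1 \<le> 2 * real K + 1" by simp
    fix A assume A: "finite A" "A \<subseteq> X"
    obtain xs where "good \<pi> (2 * real K) X xs" "A \<subseteq> span (set xs)"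
      using good_absorb_finite[OF subspace_X of_nat_0_le_iff appr A] by blast
    then show "\<exists>xs. good \<pi> (2 * real K + 1) X xs \<and> A \<subseteq> span (set xs)"
      using good_mono[of \<pi> "2 * real K" X xs "2 * real K + 1"] by auto
  qed
qed
end


section \<open>Borel complexity\<close>

text \<open>Functions carry the topology of pointwise convergence, so evaluations are
  continuous.\<close>

lemma closedin_eval_le:
  "closedin (top_of_set S) {\<mu> \<in> S. (\<mu> :: 'v \<Rightarrow> real) a \<le> c * \<mu> b}"
  "closedin (top_of_set S) {\<mu> \<in> S. (\<mu> :: 'v \<Rightarrow> real) a \<le> c}"
proof -
  have cont: "continuous_on UNIV (\<lambda>\<mu> :: 'v \<Rightarrow> real. \<mu> a)" for a
    by (rule continuous_on_product_coordinates)
  have "closed {\<mu>. (\<mu> :: 'v \<Rightarrow> real) a \<le> c * \<mu> b}" "closed {\<mu>. (\<mu> :: 'v \<Rightarrow> real) a \<le> c}"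
    by (intro closed_Collect_le cont continuous_on_mult_left continuous_on_const)+
  then show "closedin (top_of_set S) {\<mu> \<in> S. (\<mu> :: 'v \<Rightarrow> real) a \<le> c * \<mu> b}"
    "closedin (top_of_set S) {\<mu> \<in> S. (\<mu> :: 'v \<Rightarrow> real) a \<le> c}"
    by (simp_all add: closedin_closed_Int Collect_conj_eq)
qed

lemma closedin_Collect_const: "closedin (top_of_set S) {x \<in> S. P}"
  by (cases P) auto

lemma closedin_Collect_conj:
  assumes "closedin (top_of_set S) {x \<in> S. P x}" "closedin (top_of_set S) {x \<in> S. Q x}"
  shows "closedin (top_of_set S) {x \<in> S. P x \<and> Q x}"
proof -
  have "{x \<in> S. P x \<and> Q x} = {x \<in> S. P x} \<inter> {x \<in> S. Q x}" by blast
  then show ?thesis using closedin_Int[OF assms] by simp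
qed

lemma closedin_Collect_all:
  assumes "\<And>i. closedin (top_of_set S) {x \<in> S. P i x}"
  shows "closedin (top_of_set S) {x \<in> S. \<forall>i. P i x}"
proof -
  have "{x \<in> S. \<forall>i. P i x} = (\<Inter>i. {x \<in> S. P i x})" by blast
  then show ?thesis using closedin_INT[of UNIV "top_of_set S" "\<lambda>i. {x \<in> S. P i x}"] assms by simp
qed

lemma closedin_Collect_imp:
  assumes "closedin (top_of_set S) {x \<in> S. Q x}"
  shows "closedin (top_of_set S) {x \<in> S. P \<longrightarrow> Q x}"
  using assms by (cases P) auto

text \<open>\<open>\<mu>\<close> enters only through non-strict inequalities under universal
  quantifiers; independence and \<open>rat_span\<close> are constant in
  \<open>\<mu>\<close>.\<close>

lemma closedin_approx_basis: "closedin (top_of_set S) {\<mu> \<in> S. approx_basis \<mu> e K n w vs}"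
  unfolding approx_basis_def rat_basis_bound_def
  by (intro closedin_Collect_conj closedin_Collect_const closedin_Collect_all closedin_Collect_imp
      closedin_eval_le)

lemma closedin_approx_proj: "closedin (top_of_set S) {\<mu> \<in> S. approx_proj \<mu> K w N ps}"
  unfolding approx_proj_def Ball_def
  by (intro closedin_Collect_conj closedin_Collect_const closedin_Collect_all closedin_Collect_imp
      closedin_eval_le)

lemma Sigma0_compl_closedin:
  "closedin X C \<Longrightarrow> Sigma0 X 1 (topspace X - C)"
  by (rule Sigma0_open) auto

text \<open>Used alternately with \<open>Sigma0_compl_Collect_all\<close>: each countable quantifier
  raises the level by one.\<close>

lemma Sigma0_Collect_ex:
  fixes P :: "'i::countable \<Rightarrow> 'a::topological_space \<Rightarrow> bool"
  assumes "1 \<le> n" "\<And>i. Sigma0 (top_of_set S) n (S - {x \<in> S. P i x})"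
  shows "Sigma0 (top_of_set S) (Suc n) {x \<in> S. \<exists>i. P i x}"
proof -
  have "{x \<in> S. \<exists>i. P i x} = (\<Union>i. {x \<in> S. P i x})" by blast
  then show ?thesis using Sigma0_UN[of n "\<lambda>i. {x \<in> S. P i x}" "top_of_set S"] assms by auto
qed

lemma Sigma0_compl_Collect_all:
  fixes P :: "'i::countable \<Rightarrow> 'a::topological_space \<Rightarrow> bool"
  assumes "1 \<le> n" "\<And>i. Sigma0 (top_of_set S) n {x \<in> S. P i x}"
  shows "Sigma0 (top_of_set S) (Suc n) (S - {x \<in> S. \<forall>i. P i x})"
proof -
  have "{x \<in> S. \<forall>i. P i x} = (\<Inter>i. {x \<in> S. P i x})" by blast
  then show ?thesis
    using Sigma0_compl_INT[of n "\<lambda>i. {x \<in> S. P i x}" "top_of_set S"] assms by auto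
qed

lemma dense_realization_canon:
  assumes "\<mu> \<in> BN"
  shows "dense_realization (canon \<mu>) \<mu> (Xsp \<mu>)"
proof (rule dense_realization.intro)
  have PN: "\<mu> \<in> PN" and zero: "\<And>x. ext \<mu> x = 0 \<Longrightarrow> x = 0" using assms by (auto simp: BN_def)
  show lin: "linear (canon \<mu>)" by (rule canon[OF PN])
  show "inj (canon \<mu>)"
    unfolding linear_injective_0[OF lin]
  proof (intro allI impI)
    fix x assume "canon \<mu> x = 0"
    then have "ext \<mu> x = 0" using canon(2)[OF PN, of x] by simp
    then show "x = 0" by (rule zero)
  qed
  show "norm (canon \<mu> (to_c00 v)) = \<mu> v" for v
    by (simp add: canon(2)[OF PN] extension(2)[OF PN])
  show "Xsp \<mu> = closure (range (canon \<mu>))" by (simp add: Xsp_def)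
qed

text \<open>Replaces lists of rational vectors by lists of their indices, so that the quantifier
  runs over a countable type.\<close>

lemma ex_list_iff_surj:
  assumes "surj e"
  shows "(\<exists>xs. P xs) \<longleftrightarrow> (\<exists>l. P (map e l))"
proof
  assume "\<exists>xs. P xs"
  then obtain xs where "P xs" by blast
  moreover have "xs = map e (map (inv e) xs)"
    using assms by (simp add: map_idI surj_f_inv_f)
  ultimately show "\<exists>l. P (map e l)" by metis
qed auto

theorem theorem5p13:
  shows "Sigma0 (top_of_set BN) 4 {\<mu> \<in> BN. LBS (Xsp \<mu>)} \<and>
         Sigma0 (top_of_set BN) 6 {\<mu> \<in> BN. LPBS (Xsp \<mu>)}"
proof
  obtain e :: "nat \<Rightarrow> ratseq" where e: "surj e" using enum_ratseq by blast
  \<comment> \<open>The lists \<open>w\<close> and \<open>vs\<close> are coded by one pair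
    \<open>i\<close>, so that they cost a single quantifier.\<close>
  define B where "B K n i \<mu> \<longleftrightarrow> approx_basis \<mu> e (real K) n (map e (fst i)) (map e (snd i))"
    for K n :: nat and i :: "nat list \<times> nat list" and \<mu>
  define R where "R K i N l \<mu> \<longleftrightarrow> approx_proj \<mu> (real K) (map e (fst i)) N (map e l)"
    for K N :: nat and i :: "nat list \<times> nat list" and l and \<mu>
  have iff: "local_structure \<pi> (Xsp \<mu>) \<longleftrightarrow>
      (\<exists>K. \<forall>n. \<exists>i. B K n i \<mu> \<and> (\<pi> \<longrightarrow> (\<forall>N. \<exists>l. R K i N l \<mu>)))"
    if "\<mu> \<in> BN" for \<mu> \<pi>
    unfolding dense_realization.local_structure_iff[OF dense_realization_canon[OF that] e]
      B_def R_def ex_list_iff_surj[OF e] split_paired_Ex fst_conv snd_conv by (rule refl)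
  have closed_B: "closedin (top_of_set BN) {\<mu> \<in> BN. B K n i \<mu>}" for K n i
    unfolding B_def by (rule closedin_approx_basis)
  have closed_R: "closedin (top_of_set BN) {\<mu> \<in> BN. R K i N l \<mu>}" for K i N l
    unfolding R_def by (rule closedin_approx_proj)
  have closed: "Sigma0 (top_of_set BN) 1 (BN - {\<mu> \<in> BN. P \<mu>})"
    if "closedin (top_of_set BN) {\<mu> \<in> BN. P \<mu>}" for P
    using Sigma0_compl_closedin[OF that] by simp
  have "{\<mu> \<in> BN. LBS (Xsp \<mu>)} = {\<mu> \<in> BN. \<exists>K. \<forall>n. \<exists>i. B K n i \<mu>}"
    using iff[of _ False] by (auto simp: local_structure_def)
  \<comment> \<open>Starting from a closed condition at level 1, the quantifiers over
    \<open>i\<close>, \<open>n\<close> and \<open>K\<close> lead to levels 2, 3 and 4.\<close>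
  moreover have "Sigma0 (top_of_set BN) (Suc (Suc (Suc 1))) {\<mu> \<in> BN. \<exists>K. \<forall>n. \<exists>i. B K n i \<mu>}"
    by (intro Sigma0_Collect_ex Sigma0_compl_Collect_all closed closed_B) auto
  ultimately show "Sigma0 (top_of_set BN) 4 {\<mu> \<in> BN. LBS (Xsp \<mu>)}" by (simp add: eval_nat_numeral)
  \<comment> \<open>\<open>B\<close> is moved inside the quantifiers over \<open>N\<close> and
    \<open>l\<close>, so that the matrix is one closed condition under five alternating
    quantifiers.\<close>
  have "{\<mu> \<in> BN. LPBS (Xsp \<mu>)} = {\<mu> \<in> BN. \<exists>K. \<forall>n. \<exists>i. \<forall>N. \<exists>l. B K n i \<mu> \<and> R K i N l \<mu>}"
    using iff[of _ True] by (auto simp: local_structure_def)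
  moreover have "Sigma0 (top_of_set BN) (Suc (Suc (Suc (Suc (Suc 1)))))
      {\<mu> \<in> BN. \<exists>K. \<forall>n. \<exists>i. \<forall>N. \<exists>l. B K n i \<mu> \<and> R K i N l \<mu>}"
    by (intro Sigma0_Collect_ex Sigma0_compl_Collect_all closed closedin_Collect_conj closed_B closed_R)
      auto
  ultimately show "Sigma0 (top_of_set BN) 6 {\<mu> \<in> BN. LPBS (Xsp \<mu>)}" by (simp add: eval_nat_numeral)
qed

end
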